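(* Let $r,m,\ell\ge1$, let $\mathfrak q_1,\dots,\mathfrak q_\ell\in\mathbb F_q[T]$ be distinct monic irreducible polynomials of degree $m$, none equal to $T$. Put $R=\mathbb F_{q^r}\{\tau\}$, $Q_i=\mathfrak q_i(\tau^r)$, $\Pi=\prod_iQ_i$, $\mathsf N=\deg_\tau(\Pi)=m\ell r$, and $\mathcal R_\Gamma=\prod_{i=1}^\ell R/(Q_i)$ with the poly-skew metric. (1) Let $\mathcal D\subseteq\mathcal R_\Gamma$ be a nonzero $\mathbb F_q$-linear code of dimension $\kappa$ over $\mathbb F_q$ and minimum poly-skew distance $d_{\mathrm{ps}}$. Then $$\kappa\le mr\left(\ell r-\frac{d_{\mathrm{ps}}}{m}+1\right).$$ (2) If $\mathcal D$ is $\mathbb F_{q^r}$-linear of dimension $K$ over $\mathbb F_{q^r}$, then $$d_{\mathrm{ps}}\le m\left(\ell r-\left\lceil\frac Km\right\rceil+1\right).$$ (3) For the explicit code $\operatorname{SCRT}_{\Gamma,mt}$ with $1\le t\le\ell r$, one has $K=mt$ and $$d_{\mathrm{ps}}(\operatorname{SCRT}_{\Gamma,mt})=m(\ell r-t+1)=\mathsf N-K+m.$$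
   Context: $q$ is a prime power. $R=\mathbb F_{q^r}\{\tau\}$ is the skew polynomial ring with $\tau\alpha=\alpha^q\tau$ for $\alpha\in\mathbb F_{q^r}$; it is Euclidean on both sides. The elements $Q_i$ and $\Pi$ are central in $R$, so $(Q_i)=RQ_i$ and $(\Pi)=R\Pi$ are two-sided ideals. $\operatorname{gcrd}$ denotes the monic greatest common right divisor (with $\operatorname{gcrd}(\Pi,0)=\Pi$). The map $\operatorname{CRT}_\Gamma:R/(\Pi)\to\mathcal R_\Gamma$ taking $u$ to its right remainders modulo the $Q_i$ (the $H$ with $u=BQ_i+H$, $\deg_\tau H<\deg_\tau Q_i$) is an isomorphism. For $\boldsymbol y\in\mathcal R_\Gamma$ let $Y\in R$ be its CRT lift, i.e. the unique element with $\deg_\tau(Y)<\mathsf N$ and $\operatorname{CRT}_\Gamma(Y)=\boldsymbol y$. The poly-skew weight is $\operatorname{wt}_{\mathrm{ps}}(\boldsymbol y)=\mathsf N-\deg_\tau\operatorname{gcrd}(\Pi,Y)$; the minimum poly-skew distance of a nonzero $\mathbb F_q$-linear code is the minimum poly-skew weight of its nonzero elements. $\mathbb F_{q^r}$-linearity refers to left multiplication by $\mathbb F_{q^r}$. For $1\le K\le\mathsf N$, $\operatorname{SCRT}_{\Gamma,K}=\{\operatorname{CRT}_\Gamma(u):u\in R,\ \deg_\tau(u)<K\}$. *)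

theory Defs
  imports
    "HOL-Algebra.Embedded_Algebras"
    "HOL-Algebra.Chinese_Remainder"
    "HOL-Computational_Algebra.Computational_Algebra"
begin

text \<open>
  The skew polynomial \<open>\<Sum>i. a\<^sub>i \<tau>\<^sup>i\<close> (coefficients on the left) is represented by the element of
  \<open>'a poly\<close> with coefficients \<open>a\<^sub>i\<close>; only the product differs from the commutative one:
  \<open>a \<tau>\<^sup>i \<cdot> b \<tau>\<^sup>j = a b^(q^i) \<tau>^(i+j)\<close>. Thus \<open>degree\<close> is the degree in \<open>\<tau>\<close> (with \<open>degree 0 = 0\<close>), and
  \<open>Polynomial.smult a\<close> is left multiplication by the constant \<open>a\<close>.
\<close>

definition skew_mult :: "nat \<Rightarrow> 'a::field poly \<Rightarrow> 'a poly \<Rightarrow> 'a poly" where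
  "skew_mult q f g = (\<Sum>i\<le>degree f. \<Sum>j\<le>degree g.
     Polynomial.monom (Polynomial.coeff f i * Polynomial.coeff g j ^ (q ^ i)) (i + j))"

definition skew_ring :: "nat \<Rightarrow> 'a::field poly ring" where
  "skew_ring q = \<lparr>carrier = UNIV, monoid.mult = skew_mult q, one = 1, zero = 0, add = (+)\<rparr>"

definition skew_tau :: "'a::field poly" where
  "skew_tau = Polynomial.monom 1 1"

definition right_dvd :: "nat \<Rightarrow> 'a::field poly \<Rightarrow> 'a poly \<Rightarrow> bool" where
  "right_dvd q d f \<longleftrightarrow> (\<exists>b. f = skew_mult q b d)"

definition gcrd :: "nat \<Rightarrow> 'a::field poly \<Rightarrow> 'a poly \<Rightarrow> 'a poly" where
  "gcrd q f g = (THE d. lead_coeff d = 1 \<and> right_dvd q d f \<and> right_dvd q d g \<and>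
     (\<forall>e. right_dvd q e f \<and> right_dvd q e g \<longrightarrow> right_dvd q e d))"

text \<open>The value \<open>f(\<tau>\<^sup>r)\<close> for \<open>f\<close> over the small field, which embeds into \<open>'a\<close> via \<open>\<iota>\<close>.\<close>

definition eval_tau_pow :: "nat \<Rightarrow> nat \<Rightarrow> ('f::field \<Rightarrow> 'a::field) \<Rightarrow> 'f poly \<Rightarrow> 'a poly" where
  "eval_tau_pow q r \<iota> f = (\<Sum>j\<le>degree f. Polynomial.smult (\<iota> (Polynomial.coeff f j))
     ((skew_tau [^]\<^bsub>skew_ring q\<^esub> r) [^]\<^bsub>skew_ring q\<^esub> j))"

text \<open>
  In what follows \<open>Qs\<close> is the list of the central elements \<open>Q\<^sub>1, \<dots>, Q\<^sub>\<ell>\<close>, and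
  \<open>PIdl\<^bsub>skew_ring q\<^esub> Q\<close> is the set of left multiples of \<open>Q\<close>, i.e. \<open>R Q\<close>.
\<close>

definition Pi_poly :: "nat \<Rightarrow> 'a::field poly list \<Rightarrow> 'a poly" where
  "Pi_poly q Qs = foldr (skew_mult q) Qs 1"

definition prod_ring :: "nat \<Rightarrow> 'a::field poly list \<Rightarrow> 'a poly set list ring" where
  "prod_ring q Qs = RDirProd_list (map (\<lambda>Q. skew_ring q Quot (PIdl\<^bsub>skew_ring q\<^esub> Q)) Qs)"

text \<open>
  The \<open>i\<close>-th component is the residue class of \<open>u\<close> modulo \<open>Q\<^sub>i\<close>, which is also the class of the
  right remainder of \<open>u\<close> on division by \<open>Q\<^sub>i\<close>.
\<close>

definition CRT :: "nat \<Rightarrow> 'a::field poly list \<Rightarrow> 'a poly \<Rightarrow> 'a poly set list" where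
  "CRT q Qs u = map (\<lambda>Q. (PIdl\<^bsub>skew_ring q\<^esub> Q) +>\<^bsub>skew_ring q\<^esub> u) Qs"

definition CRT_lift :: "nat \<Rightarrow> 'a::field poly list \<Rightarrow> 'a poly set list \<Rightarrow> 'a poly" where
  "CRT_lift q Qs y = (THE Y. degree Y < degree (Pi_poly q Qs) \<and> CRT q Qs Y = y)"

definition wt_ps :: "nat \<Rightarrow> 'a::field poly list \<Rightarrow> 'a poly set list \<Rightarrow> nat" where
  "wt_ps q Qs y =
     degree (Pi_poly q Qs) - degree (gcrd q (Pi_poly q Qs) (CRT_lift q Qs y))"

definition d_ps :: "nat \<Rightarrow> 'a::field poly list \<Rightarrow> 'a poly set list set \<Rightarrow> nat" where
  "d_ps q Qs D = (LEAST w. \<exists>y\<in>D. y \<noteq> \<zero>\<^bsub>prod_ring q Qs\<^esub> \<and> wt_ps q Qs y = w)"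

text \<open>Only used for \<open>K \<ge> 1\<close>, where the zero polynomial satisfies \<open>degree u < K\<close>.\<close>

definition SCRT :: "nat \<Rightarrow> 'a::field poly list \<Rightarrow> nat \<Rightarrow> 'a poly set list set" where
  "SCRT q Qs K = CRT q Qs ` {u. degree u < K}"

text \<open>
  The image in the product ring of a set \<open>S\<close> of constants. Left multiplication by an element of
  \<open>scalars q Qs S\<close> is componentwise left multiplication by a constant in \<open>S\<close>, so that linearity and
  dimension over \<open>S\<close> are \<^const>\<open>subalgebra\<close> and \<^const>\<open>ring.dimension\<close> over this subfield.
\<close>

definition scalars :: "nat \<Rightarrow> 'a::field poly list \<Rightarrow> 'a set \<Rightarrow> 'a poly set list set" where
  "scalars q Qs S = (\<lambda>a. CRT q Qs [:a:]) ` S"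

end

theory Submission
  imports Defs "HOL-Algebra.Algebraic_Closure_Type"
begin

text \<open>
  Let \<open>\<Omega>\<close> be an algebraic closure of \<open>\<F>\<^sub>q\<^sub>r\<close>, on which \<open>\<tau>\<close> acts as the \<open>q\<close>-Frobenius. A skew polynomial
  with nonzero constant coefficient acts by a separable linearized polynomial, so its kernel in \<open>\<Omega>\<close>
  has \<open>q\<^sup>d\<close> elements, where \<open>d\<close> is its degree. The kernel \<open>W\<close> of \<open>\<Pi>\<close> is a module over \<open>\<F>\<^sub>q[T]\<close>, with
  \<open>T\<close> acting as \<open>\<tau>\<^sup>r\<close>, and it is killed by the product of the irreducible polynomials \<open>\<qq>\<^sub>i\<close> of
  degree \<open>m\<close>. The monic right divisors of \<open>\<Pi>\<close> are the annihilators of the submodules of \<open>W\<close>, and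
  these have a composition series with factors of order \<open>q\<^sup>m\<close>. So the degrees of the right divisors of
  \<open>\<Pi>\<close> are exactly the multiples of \<open>m\<close> up to \<open>N\<close>, and all weights are multiples of \<open>m\<close>. The two
  bounds follow by comparing a code with the left ideal of a right divisor of degree
  \<open>N - (d\<^sub>p\<^sub>s - m)\<close>, which meets it trivially. For the code of all \<open>u\<close> of degree less than \<open>mt\<close>, a
  nonzero \<open>u\<close> has \<open>gcrd(\<Pi>, u)\<close> of degree at most \<open>m(t - 1)\<close>, with equality if \<open>u\<close> is a right divisor.
\<close>

section \<open>Skew polynomials: ring laws, degree, right division and gcrd\<close>

hide_const (open) Polynomials.degree Polynomials.lead_coeff

text \<open>Identities additive in each argument, such as associativity of the skew product, thereby
  need checking on monomials only.\<close>

lemma poly_monom_induct [case_names monom add]: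
  fixes f :: "'b::comm_monoid_add poly"
  assumes monom: "\<And>a i. P (Polynomial.monom a i)"
    and add: "\<And>f g. P f \<Longrightarrow> P g \<Longrightarrow> P (f + g)"
  shows "P f"
proof -
  have "P (\<Sum>i\<in>A. Polynomial.monom (Polynomial.coeff f i) i)" if "finite A" for A
    using that
  proof (induction A)
    case empty
    then show ?case using monom[of 0 0] by simp
  next
    case (insert i A)
    then show ?case using add[OF monom] by simp
  qed
  from this[of "{..degree f}"] show ?thesis
    by (simp add: poly_as_sum_of_monoms)
qed

lemma coeff_skew_mult:
  fixes f g :: "'b::field poly"
  assumes "0 < q"
  shows "Polynomial.coeff (skew_mult q f g) n =
    (\<Sum>i\<le>n. Polynomial.coeff f i * Polynomial.coeff g (n - i) ^ (q ^ i))"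
proof -
  let ?t = "\<lambda>i. Polynomial.coeff f i * Polynomial.coeff g (n - i) ^ (q ^ i)"
  have "Polynomial.coeff (skew_mult q f g) n =
      (\<Sum>i\<le>degree f. \<Sum>j\<le>degree g. if i + j = n then Polynomial.coeff f i * Polynomial.coeff g j ^ (q ^ i) else 0)"
    by (simp add: skew_mult_def coeff_sum)
  also have "\<dots> = (\<Sum>i\<le>degree f. if i \<le> n then ?t i else 0)"
  proof (rule sum.cong[OF refl])
    fix i
    have "(\<Sum>j\<le>degree g. if i + j = n then Polynomial.coeff f i * Polynomial.coeff g j ^ (q ^ i) else 0) =
      (\<Sum>j\<le>degree g. if j = n - i then (if i \<le> n then ?t i else 0) else 0)"
      by (intro sum.cong) auto
    also have "\<dots> = (if i \<le> n then ?t i else 0)"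
      \<comment> \<open>The index \<open>n - i\<close> may exceed \<open>degree g\<close>; the
        coefficient there is 0, and so is its power because \<open>q ^ i\<close> is
        positive.\<close>
      using assms by (auto simp: coeff_eq_0)
    finally show "(\<Sum>j\<le>degree g. if i + j = n then Polynomial.coeff f i * Polynomial.coeff g j ^ (q ^ i) else 0) =
      (if i \<le> n then ?t i else 0)" .
  qed
  also have "\<dots> = (\<Sum>i\<in>{..degree f} \<inter> {..n}. ?t i)"
    by (subst sum.inter_restrict) auto
  also have "\<dots> = (\<Sum>i\<le>n. ?t i)"
    by (rule sum.mono_neutral_left) (auto simp: coeff_eq_0)
  finally show ?thesis .
qed

text \<open>When the Frobenius twist has no effect, the product is the commutative one. For central
  elements this makes the commutative \<open>dvd\<close>, \<open>mod\<close> and substitution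
  available.\<close>

lemma skew_mult_eq_mult:
  fixes f g :: "'b::field poly"
  assumes "0 < q"
    and "\<And>i j. Polynomial.coeff f i = 0 \<or> Polynomial.coeff g j ^ (q ^ i) = Polynomial.coeff g j"
  shows "skew_mult q f g = f * g"
proof (rule poly_eqI)
  fix n
  show "Polynomial.coeff (skew_mult q f g) n = Polynomial.coeff (f * g) n"
    unfolding coeff_skew_mult[OF assms(1)] coeff_mult
    by (rule sum.cong[OF refl]) (metis assms(2) mult_zero_left)
qed

lemma skew_mult_const_left:
  fixes g :: "'b::field poly"
  assumes "0 < q"
  shows "skew_mult q [:a:] g = Polynomial.smult a g"
proof (subst skew_mult_eq_mult[OF assms])
  show "Polynomial.coeff [:a:] i = 0 \<or> Polynomial.coeff g j ^ q ^ i = Polynomial.coeff g j" for i j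
    by (cases i) auto
qed simp

text \<open>Additivity of the \<open>q\<close>-th power is taken as the assumption so that one
  theory serves both the finite field and its algebraic closure.\<close>

locale frobenius =
  fixes q :: nat and F :: "'b::field itself"
  assumes q_gt_1: "1 < q"
    and frob_add: "\<And>x y :: 'b. (x + y) ^ q = x ^ q + y ^ q"
begin

abbreviation smul :: "'b poly \<Rightarrow> 'b poly \<Rightarrow> 'b poly" (infixl "\<star>" 70)
  where "f \<star> g \<equiv> skew_mult q f g"

lemma q_pos: "0 < q"
  using q_gt_1 by simp

lemma frob_pow_add: "(x + y :: 'b) ^ (q ^ i) = x ^ (q ^ i) + y ^ (q ^ i)"
proof (induction i)
  case (Suc i)
  have "(x + y) ^ (q ^ Suc i) = ((x + y) ^ (q ^ i)) ^ q"
    by (metis power_Suc2 power_mult)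
  also have "\<dots> = (x ^ q ^ i) ^ q + (y ^ q ^ i) ^ q"
    by (simp add: Suc frob_add)
  also have "\<dots> = x ^ (q ^ Suc i) + y ^ (q ^ Suc i)"
    by (metis power_Suc2 power_mult)
  finally show ?case .
qed auto

lemma frob_pow_0 [simp]: "(0 :: 'b) ^ (q ^ i) = 0"
  using q_pos by simp

lemma frob_pow_minus: "(- x :: 'b) ^ (q ^ i) = - (x ^ (q ^ i))"
  using frob_pow_add[of x "- x" i] by (simp add: eq_neg_iff_add_eq_0 add.commute)

lemma frob_pow_diff: "(x - y :: 'b) ^ (q ^ i) = x ^ (q ^ i) - y ^ (q ^ i)"
  using frob_pow_add[of x "- y" i] by (simp add: frob_pow_minus)

lemma frob_pow_sum: "(\<Sum>x\<in>A. f x :: 'b) ^ (q ^ i) = (\<Sum>x\<in>A. f x ^ (q ^ i))"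
  by (induction A rule: infinite_finite_induct) (simp_all add: frob_pow_add)

lemma skew_add_left: "(f + g) \<star> h = f \<star> h + g \<star> h"
  by (rule poly_eqI) (simp add: coeff_skew_mult q_pos sum.distrib algebra_simps)

lemma skew_add_right: "h \<star> (f + g) = h \<star> f + h \<star> g"
  by (rule poly_eqI) (simp add: coeff_skew_mult q_pos sum.distrib algebra_simps frob_pow_add)

lemma skew_0_left [simp]: "0 \<star> f = 0"
  by (rule poly_eqI) (simp add: coeff_skew_mult q_pos)

lemma skew_0_right [simp]: "f \<star> 0 = 0"
  by (rule poly_eqI) (simp add: coeff_skew_mult q_pos)

lemma skew_minus_left: "(- f) \<star> h = - (f \<star> h)"
  by (rule poly_eqI) (simp add: coeff_skew_mult q_pos sum_negf)

lemma skew_diff_left: "(f - g) \<star> h = f \<star> h - g \<star> h"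
  using skew_add_left[of f "- g" h] by (simp add: skew_minus_left)

lemma skew_monom: "Polynomial.monom a i \<star> Polynomial.monom b j = Polynomial.monom (a * b ^ (q ^ i)) (i + j)"
proof -
  have "(\<Sum>k\<le>n. (if i = k then a else 0) * (if j = n - k then b else 0) ^ q ^ k) =
      (if i + j = n then a * b ^ q ^ i else 0)" for n
  proof -
    have "(\<Sum>k\<le>n. (if i = k then a else 0) * (if j = n - k then b else 0) ^ q ^ k) =
      (\<Sum>k\<le>n. if k = i then a * (if j = n - i then b else 0) ^ q ^ i else 0)"
      by (intro sum.cong) (auto simp: q_pos)
    also have "\<dots> = (if i + j = n then a * b ^ q ^ i else 0)"
      by (auto simp: q_pos)
    finally show ?thesis .
  qed
  then show ?thesis
    by (intro poly_eqI) (simp add: coeff_skew_mult q_pos)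
qed

text \<open>On monomials with coefficients \<open>a\<close>, \<open>b\<close>, \<open>c\<close> and
  exponents \<open>i\<close>, \<open>j\<close>, \<open>k\<close>, both sides have the coefficient
  \<open>a * b ^ (q ^ i) * c ^ (q ^ (i + j))\<close>.\<close>

lemma skew_assoc: "(f \<star> g) \<star> h = f \<star> (g \<star> h)"
proof (induction f rule: poly_monom_induct)
  case (monom a i)
  show ?case
  proof (induction g rule: poly_monom_induct)
    case (monom b j)
    show ?case
    proof (induction h rule: poly_monom_induct)
      case (monom c k)
      show ?case
        by (simp add: skew_monom power_mult_distrib power_add mult_ac add_ac flip: power_mult)
    qed (simp add: skew_add_right)
  qed (simp add: skew_add_right skew_add_left)
qed (simp add: skew_add_left)

lemma skew_1_left [simp]: "1 \<star> f = f"
  using skew_mult_const_left[OF q_pos, of 1 f] by (simp add: one_pCons)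

lemma skew_1_right [simp]: "f \<star> 1 = f"
proof -
  have "f \<star> 1 = f * 1"
    by (rule skew_mult_eq_mult[OF q_pos]) (auto simp: coeff_1)
  then show ?thesis by simp
qed

lemma degree_skew_le: "degree (f \<star> g) \<le> degree f + degree g"
proof (rule degree_le, intro allI impI)
  fix n assume "degree f + degree g < n"
  then have "Polynomial.coeff f i * Polynomial.coeff g (n - i) ^ (q ^ i) = 0" for i
    by (cases "degree f < i") (auto simp: coeff_eq_0 q_pos)
  then show "Polynomial.coeff (f \<star> g) n = 0"
    unfolding coeff_skew_mult[OF q_pos] by (intro sum.neutral ballI)
qed

text \<open>A power of a nonzero field element is nonzero, so the twisted leading term survives:
  degrees add up and there are no zero divisors.\<close>

lemma coeff_skew_top:
  "Polynomial.coeff (f \<star> g) (degree f + degree g) = lead_coeff f * lead_coeff g ^ (q ^ degree f)"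
proof -
  have "Polynomial.coeff (f \<star> g) (degree f + degree g) =
    (\<Sum>i\<in>{degree f}. Polynomial.coeff f i * Polynomial.coeff g (degree f + degree g - i) ^ (q ^ i))"
    unfolding coeff_skew_mult[OF q_pos]
  proof (rule sum.mono_neutral_right)
    show "\<forall>i\<in>{..degree f + degree g} - {degree f}.
        Polynomial.coeff f i * Polynomial.coeff g (degree f + degree g - i) ^ q ^ i = 0"
    proof
      fix i assume "i \<in> {..degree f + degree g} - {degree f}"
      then show "Polynomial.coeff f i * Polynomial.coeff g (degree f + degree g - i) ^ q ^ i = 0"
        by (cases "degree f < i") (auto simp: coeff_eq_0 q_pos)
    qed
  qed auto
  then show ?thesis by simp
qed

lemma degree_skew: "f \<noteq> 0 \<Longrightarrow> g \<noteq> 0 \<Longrightarrow> degree (f \<star> g) = degree f + degree g"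
  by (intro antisym degree_skew_le le_degree) (simp add: coeff_skew_top)

lemma skew_eq_0_iff [simp]: "f \<star> g = 0 \<longleftrightarrow> f = 0 \<or> g = 0"
  using coeff_skew_top[of f g] by (metis coeff_0 leading_coeff_0_iff mult_eq_0_iff power_eq_0_iff skew_0_left skew_0_right)

lemma coeff_0_skew: "Polynomial.coeff (f \<star> g) 0 = Polynomial.coeff f 0 * Polynomial.coeff g 0"
  by (simp add: coeff_skew_mult q_pos)

lemma right_division:
  assumes "g \<noteq> 0"
  obtains b h where "f = b \<star> g + h" "h = 0 \<or> degree h < degree g"
proof -
  have "\<exists>b h. f = b \<star> g + h \<and> (h = 0 \<or> degree h < degree g)"
  \<comment> \<open>Since \<open>degree 0 = 0\<close>, the measure is shifted by one to separate 0
    from the nonzero constants.\<close>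
  proof (induction "if f = 0 then 0 else Suc (degree f)" arbitrary: f rule: less_induct)
    case less
    show ?case
    proof (cases "f = 0 \<or> degree f < degree g")
      case True
      then show ?thesis by (intro exI[of _ 0] exI[of _ f]) auto
    next
      case False
      define k where "k = degree f - degree g"
      \<comment> \<open>Moving \<open>g\<close> past the \<open>k\<close>-th power of the variable
        raises its leading coefficient to the power \<open>q ^ k\<close>; the divisor in
        \<open>c\<close> compensates for this.\<close>
      define c where "c = Polynomial.monom (lead_coeff f / lead_coeff g ^ (q ^ k)) k"
      have c: "c \<noteq> 0" "degree c = k" "lead_coeff c = lead_coeff f / lead_coeff g ^ (q ^ k)"
        using False assms by (simp_all add: c_def degree_monom_eq)
      have deg: "degree (c \<star> g) = degree f"
        using c False assms by (simp add: degree_skew k_def)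
      have lc: "lead_coeff (c \<star> g) = lead_coeff f"
        using coeff_skew_top[of c g] c deg False assms
        by (simp add: k_def)
      let ?f = "f - c \<star> g"
      have "(if ?f = 0 then 0 else Suc (degree ?f)) < (if f = 0 then 0 else Suc (degree f))"
      proof (cases "?f = 0")
        case nz: False
        have "degree ?f \<le> degree f"
          using deg degree_diff_le by (metis order_refl)
        moreover have "Polynomial.coeff ?f (degree f) = 0"
          using deg lc by simp
        ultimately have "degree ?f < degree f"
          using nz by (metis le_neq_implies_less leading_coeff_0_iff)
        then show ?thesis using False by auto
      qed (use False in auto)
      from less[OF this] obtain b h where "?f = b \<star> g + h" "h = 0 \<or> degree h < degree g"
        by blast
      then show ?thesis
        by (intro exI[of _ "b + c"] exI[of _ h]) (simp add: skew_add_left algebra_simps)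
    qed
  qed
  then show ?thesis using that by blast
qed

text \<open>Mutual right divisors have equal degree, so they differ by a constant left factor, which
  is 1 for monic ones. This is the uniqueness behind the \<open>THE\<close> in
  \<open>gcrd\<close>.\<close>

lemma right_dvd_antisym_monic:
  assumes "right_dvd q (d :: 'b poly) e" "right_dvd q e d" "lead_coeff d = 1" "lead_coeff e = 1"
  shows "d = e"
proof -
  obtain a b where ab: "e = a \<star> d" "d = b \<star> e"
    using assms by (auto simp: right_dvd_def)
  have nz: "d \<noteq> 0" "e \<noteq> 0" using assms(3,4) by auto
  then have nz': "a \<noteq> 0" "b \<noteq> 0" using ab by force+
  have "degree e = degree a + degree d" "degree d = degree b + degree e"
    using degree_skew[OF nz'(1) nz(1)] degree_skew[OF nz'(2) nz(2)]
    unfolding ab(1,2)[symmetric] by auto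
  then have "degree a = 0" by simp
  then obtain c where c: "a = [:c:]" by (rule degree_eq_zeroE)
  then have "e = Polynomial.smult c d"
    using ab(1) skew_mult_const_left[OF q_pos, of c d] by simp
  then show ?thesis using assms(3,4) by (cases "c = 0") auto
qed

text \<open>Right division shows that the left ideal \<open>I\<close> generated by \<open>f\<close>
  and \<open>g\<close> consists of the left multiples of a monic element of least degree. Being a
  combination of \<open>f\<close> and \<open>g\<close>, this element is right divisible by each
  common right divisor.\<close>

lemma gcrd_props:
  assumes "(f :: 'b poly) \<noteq> 0"
  shows "lead_coeff (gcrd q f g) = 1" "right_dvd q (gcrd q f g) f" "right_dvd q (gcrd q f g) g"
    "right_dvd q e f \<Longrightarrow> right_dvd q e g \<Longrightarrow> right_dvd q e (gcrd q f g)"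
proof -
  define I where "I = {a \<star> f + b \<star> g | a b. True}"
  have I_f: "f \<in> I" unfolding I_def by (rule CollectI, rule exI[of _ 1], rule exI[of _ 0]) simp
  have I_g: "g \<in> I" unfolding I_def by (rule CollectI, rule exI[of _ 0], rule exI[of _ 1]) simp
  have I_mult: "c \<star> h \<in> I" if h: "h \<in> I" for c h
  proof -
    obtain a b where "h = a \<star> f + b \<star> g" using h unfolding I_def by blast
    then have "c \<star> h = (c \<star> a) \<star> f + (c \<star> b) \<star> g"
      by (simp add: skew_add_right skew_assoc)
    then show ?thesis unfolding I_def by blast
  qed
  have I_diff: "h - k \<in> I" if hk: "h \<in> I" "k \<in> I" for h k
  proof -
    obtain a b c d where "h = a \<star> f + b \<star> g" "k = c \<star> f + d \<star> g"
      using hk unfolding I_def by blast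
    then have "h - k = (a - c) \<star> f + (b - d) \<star> g"
      by (simp add: skew_diff_left)
    then show ?thesis unfolding I_def by blast
  qed
  define d0 where "d0 = (ARG_MIN degree e. e \<in> I \<and> e \<noteq> 0)"
  have d0: "d0 \<in> I" "d0 \<noteq> 0" and min: "\<And>e. e \<in> I \<Longrightarrow> e \<noteq> 0 \<Longrightarrow> degree d0 \<le> degree e"
    using arg_min_nat_lemma[of "\<lambda>e. e \<in> I \<and> e \<noteq> 0" f degree] I_f assms unfolding d0_def by blast+
  define d where "d = Polynomial.smult (inverse (lead_coeff d0)) d0"
  have d: "d \<in> I" "d \<noteq> 0" "lead_coeff d = 1" "degree d = degree d0"
    using d0 I_mult[OF d0(1), of "[:inverse (lead_coeff d0):]"]
    by (simp_all add: d_def skew_mult_const_left q_pos)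
  have dvd: "right_dvd q d h" if "h \<in> I" for h
  proof -
    obtain b k where bk: "h = b \<star> d + k" "k = 0 \<or> degree k < degree d"
      by (rule right_division[OF d(2)])
    have "k = h - b \<star> d" using bk by simp
    then have "k \<in> I" using I_diff[OF that I_mult[OF d(1)]] by simp
    then have "k = 0" using min[of k] bk(2) d(4) by (cases "k = 0") auto
    then show ?thesis using bk by (auto simp: right_dvd_def)
  qed
  let ?P = "\<lambda>d. lead_coeff d = 1 \<and> right_dvd q d f \<and> right_dvd q d g \<and>
     (\<forall>e. right_dvd q e f \<and> right_dvd q e g \<longrightarrow> right_dvd q e d)"
  have great: "right_dvd q e d" if ef: "right_dvd q e f" and eg: "right_dvd q e g" for e
  proof -
    obtain a b where "d = a \<star> f + b \<star> g" using d(1) unfolding I_def by blast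
    moreover obtain x y where "f = x \<star> e" "g = y \<star> e" using ef eg by (auto simp: right_dvd_def)
    ultimately have "d = (a \<star> x + b \<star> y) \<star> e"
      by (simp add: skew_add_left skew_assoc)
    then show ?thesis by (auto simp: right_dvd_def)
  qed
  have P: "?P d" using d dvd I_f I_g great by blast
  have "?P (gcrd q f g)"
    unfolding gcrd_def
  proof (rule theI[of ?P, OF P])
    fix e assume "?P e"
    then show "e = d" using P right_dvd_antisym_monic[of d e] by blast
  qed
  then show "lead_coeff (gcrd q f g) = 1" "right_dvd q (gcrd q f g) f" "right_dvd q (gcrd q f g) g"
    "right_dvd q e f \<Longrightarrow> right_dvd q e g \<Longrightarrow> right_dvd q e (gcrd q f g)"
    by blast+
qed

lemma right_dvd_degree_le:
  "right_dvd q (d :: 'b poly) f \<Longrightarrow> f \<noteq> 0 \<Longrightarrow> degree d \<le> degree f"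
  unfolding right_dvd_def using degree_skew by fastforce

end

section \<open>Linearized polynomials\<close>

text \<open>An ordinary polynomial with the same values as the operator
  \<open>skew_eval q f\<close>, so that root counts apply to kernels.\<close>

definition lin_poly :: "nat \<Rightarrow> 'b::field poly \<Rightarrow> 'b poly" where
  "lin_poly q f = (\<Sum>i\<le>degree f. Polynomial.monom (Polynomial.coeff f i) (q ^ i))"

definition skew_eval :: "nat \<Rightarrow> 'b::field poly \<Rightarrow> 'b \<Rightarrow> 'b" where
  "skew_eval q f x = (\<Sum>i\<le>degree f. Polynomial.coeff f i * x ^ (q ^ i))"

definition skew_ker :: "nat \<Rightarrow> 'b::field poly \<Rightarrow> 'b set" where
  "skew_ker q f = {x. skew_eval q f x = 0}"

lemma poly_lin_poly: "poly (lin_poly q f) x = skew_eval q f x"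
  by (simp add: lin_poly_def skew_eval_def poly_sum poly_monom)

text \<open>A repeated linear factor would make the derivative vanish at a root, so the linear
  factors are distinct.\<close>

lemma card_roots_separable:
  fixes p :: "'b::alg_closed_field poly"
  assumes "p \<noteq> 0" and sep: "\<And>x. poly p x = 0 \<Longrightarrow> poly (pderiv p) x \<noteq> 0"
  shows "card {x. poly p x = 0} = degree p"
proof -
  obtain A where A: "size A = degree p" "p = Polynomial.smult (lead_coeff p) (\<Prod>x\<in>#A. [:-x, 1:])"
    using alg_closed_imp_factorization[OF assms(1)] by blast
  have count: "count A x = 1" if "x \<in># A" for x
  proof (rule ccontr)
    assume "count A x \<noteq> 1"
    with that obtain B where B: "A = add_mset x (add_mset x B)"
      by (metis insert_DiffM not_in_iff count_add_mset One_nat_def)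
    define g where "g = Polynomial.smult (lead_coeff p) (\<Prod>y\<in>#B. [:-y, 1:])"
    have p: "p = [:-x, 1:] * ([:-x, 1:] * g)"
      by (subst A(2), simp add: B g_def mult_ac)
    \<comment> \<open>By the product rule only the term that differentiates the linear factor
      survives at \<open>x\<close>; with a second factor vanishing at \<open>x\<close> nothing is
      left.\<close>
    have "poly (pderiv ([:-x, 1:] * r)) x = poly r x" for r
      by (simp only: pderiv_mult poly_add poly_mult) (simp add: pderiv_pCons)
    from this[of "[:-x, 1:] * g"] have "poly (pderiv p) x = 0"
      unfolding p[symmetric] by simp
    moreover have "poly p x = 0"
      by (subst p) simp
    ultimately show False using sep by blast
  qed
  have "{x. poly p x = 0} = set_mset A"
    by (subst A(2)) (use assms(1) in \<open>auto simp: poly_prod_mset\<close>)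
  moreover have "size A = card (set_mset A)"
    using count by (simp add: size_multiset_overloaded_eq)
  ultimately show ?thesis using A(1) by simp
qed

section \<open>Embeddings of fields and the image of a finite field\<close>

locale field_embedding =
  fixes h :: "'k::field \<Rightarrow> 'b::field"
  assumes h_add: "h (x + y) = h x + h y" and h_mult: "h (x * y) = h x * h y" and h_1 [simp]: "h 1 = 1"
begin

lemma h_0 [simp]: "h 0 = 0"
  using h_add[of 0 0] by (metis add_0_right add_left_cancel)

lemma h_minus: "h (- x) = - h x"
  using h_add[of x "- x"] by (simp add: eq_neg_iff_add_eq_0 add.commute)

lemma h_diff: "h (x - y) = h x - h y"
  using h_add[of x "- y"] by (simp add: h_minus)

lemma h_eq_0_iff [simp]: "h x = 0 \<longleftrightarrow> x = 0"
proof
  assume "h x = 0"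
  then show "x = 0"
    using h_mult[of x "inverse x"] by (cases "x = 0") auto
qed simp

lemma h_eq_iff [simp]: "h x = h y \<longleftrightarrow> x = y"
  using h_eq_0_iff[of "x - y"] by (simp add: h_diff)

lemma inj_h: "inj h"
  by (simp add: inj_def)

lemma h_power: "h (x ^ n) = h x ^ n"
  by (induction n) (simp_all add: h_mult)

lemma h_sum: "h (sum f A) = (\<Sum>x\<in>A. h (f x))"
  by (induction A rule: infinite_finite_induct) (simp_all add: h_add)

lemma h_of_nat: "h (of_nat n) = of_nat n"
  by (induction n) (simp_all add: h_add)

lemma degree_map [simp]: "degree (map_poly h f) = degree f"
  by (rule degree_map_poly) simp

lemma coeff_map [simp]: "Polynomial.coeff (map_poly h f) i = h (Polynomial.coeff f i)"
  by (simp add: coeff_map_poly)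

lemma map_eq_0_iff [simp]: "map_poly h f = 0 \<longleftrightarrow> f = 0"
  by (simp add: poly_eq_iff)

lemma map_add: "map_poly h (f + g) = map_poly h f + map_poly h g"
  by (rule poly_eqI) (simp add: h_add)

lemma map_mult: "map_poly h (f * g) = map_poly h f * map_poly h g"
  by (rule poly_eqI) (simp add: coeff_mult h_sum h_mult)

lemma map_skew: "0 < q \<Longrightarrow> map_poly h (skew_mult q f g) = skew_mult q (map_poly h f) (map_poly h g)"
  by (rule poly_eqI) (simp add: coeff_skew_mult h_sum h_mult h_power)

end

lemma field_embedding_comp:
  "field_embedding f \<Longrightarrow> field_embedding g \<Longrightarrow> field_embedding (\<lambda>x. g (f x))"
  by (simp add: field_embedding_def)

lemma field_embedding_to_ac: "field_embedding to_ac"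
  by (simp add: field_embedding_def)

text \<open>With \<open>n\<close> the order of the finite field, \<open>X ^ n - X\<close> has at
  most \<open>n\<close> roots, and the \<open>n\<close> elements of the image are already
  roots.\<close>

lemma (in field_embedding) range_eq_fixed:
  assumes "finite (UNIV :: 'k set)"
  shows "range h = {y. y ^ card (UNIV :: 'k set) = y}"
proof (rule card_seteq)
  let ?n = "card (UNIV :: 'k set)"
  have n: "1 < ?n"
    using card_mono[OF assms, of "{0, 1}"] by simp
  define p :: "'b poly" where "p = Polynomial.monom 1 ?n - Polynomial.monom 1 1"
  have p: "p \<noteq> 0"
  proof
    assume "p = 0"
    then have "Polynomial.coeff p ?n = 0" by simp
    then show False using n by (simp add: p_def)
  qed
  have roots: "{y. y ^ ?n = y} = {y. poly p y = 0}"
    by (simp add: p_def poly_monom)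
  show "finite {y :: 'b. y ^ ?n = y}"
    unfolding roots by (rule poly_roots_finite[OF p])
  have "degree p \<le> ?n"
    unfolding p_def using n by (intro degree_diff_le) (simp_all add: degree_monom_eq)
  then show "card {y :: 'b. y ^ ?n = y} \<le> card (range h)"
    unfolding roots card_image[OF inj_h] using card_poly_roots_bound[OF p] by simp
  show "range h \<subseteq> {y. y ^ ?n = y}"
  proof safe
    fix x :: 'k
    have "x ^ ?n = x"
    proof (cases "x = 0")
      case False
      \<comment> \<open>Multiplication by a nonzero \<open>x\<close> permutes the nonzero elements;
        cancelling their product leaves a power of \<open>x\<close> equal to 1.\<close>
      have "(\<Prod>y\<in>UNIV-{0}. x * y) = (\<Prod>y\<in>UNIV-{0}. y)"
        by (rule prod.reindex_bij_witness[of _ "\<lambda>y. y / x" "\<lambda>y. x * y"]) (use False in auto)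
      then have "x ^ card (UNIV - {0::'k}) = 1"
        using assms by (simp add: prod.distrib)
      moreover have "?n = Suc (card (UNIV - {0::'k}))"
        using assms by (intro card.remove) auto
      ultimately show ?thesis by (simp only: power_Suc mult_1_right)
    qed (use n in auto)
    then show "h x ^ ?n = h x" using h_power[of x ?n] by simp
  qed
qed

section \<open>Skew polynomials as additive operators and their kernels\<close>

context frobenius
begin

lemma skew_eval_altdef: "degree f \<le> n \<Longrightarrow> skew_eval q f x = (\<Sum>i\<le>n. Polynomial.coeff f i * (x :: 'b) ^ (q ^ i))"
  unfolding skew_eval_def by (rule sum.mono_neutral_left) (auto simp: coeff_eq_0)

lemma skew_eval_add: "skew_eval q (f + g) (x :: 'b) = skew_eval q f x + skew_eval q g x"
proof -
  let ?n = "max (degree f) (degree g)"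
  show ?thesis
    using skew_eval_altdef[of "f + g" ?n x] skew_eval_altdef[of f ?n x] skew_eval_altdef[of g ?n x]
      degree_add_le_max[of f g]
    by (simp add: sum.distrib algebra_simps)
qed

lemma skew_eval_minus: "skew_eval q (- f) (x :: 'b) = - skew_eval q f x"
  by (simp add: skew_eval_def sum_negf)

lemma skew_eval_diff: "skew_eval q (f - g) (x :: 'b) = skew_eval q f x - skew_eval q g x"
  using skew_eval_add[of f "- g" x] by (simp add: skew_eval_minus)

lemma skew_eval_0 [simp]: "skew_eval q 0 (x :: 'b) = 0"
  by (simp add: skew_eval_def)

lemma skew_eval_1 [simp]: "skew_eval q 1 (x :: 'b) = x"
  by (simp add: skew_eval_def)

lemma skew_eval_monom: "skew_eval q (Polynomial.monom a i) (x :: 'b) = a * x ^ (q ^ i)"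
proof -
  have "skew_eval q (Polynomial.monom a i) x = (\<Sum>j\<le>i. if j = i then a * x ^ (q ^ i) else 0)"
    by (subst skew_eval_altdef[OF degree_monom_le], intro sum.cong) auto
  then show ?thesis by simp
qed

lemma skew_eval_add_right: "skew_eval q f (x + y :: 'b) = skew_eval q f x + skew_eval q f y"
  by (simp add: skew_eval_def frob_pow_add sum.distrib algebra_simps)

lemma skew_eval_0_right [simp]: "skew_eval q f (0 :: 'b) = 0"
  by (simp add: skew_eval_def)

lemma skew_eval_minus_right: "skew_eval q f (- x :: 'b) = - skew_eval q f x"
  by (simp add: skew_eval_def frob_pow_minus sum_negf)

lemma skew_eval_diff_right: "skew_eval q f (x - y :: 'b) = skew_eval q f x - skew_eval q f y"
  using skew_eval_add_right[of f x "- y"] by (simp add: skew_eval_minus_right)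

text \<open>The skew product becomes composition of operators, so a right divisor has a smaller
  kernel. Additivity in both factors reduces the claim to monomials.\<close>

lemma skew_eval_mult: "skew_eval q (f \<star> g) (x :: 'b) = skew_eval q f (skew_eval q g x)"
proof (induction f rule: poly_monom_induct)
  case (monom a i)
  show ?case
  proof (induction g rule: poly_monom_induct)
    case (monom b j)
    show ?case
      by (simp add: skew_monom skew_eval_monom power_mult_distrib power_add mult_ac flip: power_mult)
  qed (simp add: skew_add_right skew_eval_add skew_eval_add_right)
qed (simp add: skew_add_left skew_eval_add)

lemma fixed_pow: "(c :: 'b) ^ q = c \<Longrightarrow> c ^ (q ^ i) = c"
  by (induction i) (simp_all add: power_mult)

lemma skew_eval_scale: "(c :: 'b) ^ q = c \<Longrightarrow> skew_eval q f (c * x) = c * skew_eval q f x"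
  by (simp add: skew_eval_def sum_distrib_left power_mult_distrib fixed_pow mult_ac)

lemma q_pow_inj: "q ^ i = q ^ j \<longleftrightarrow> i = j"
  using power_inject_exp[OF q_gt_1] by blast

lemma coeff_lin_poly: "Polynomial.coeff (lin_poly q (f :: 'b poly)) (q ^ i) = Polynomial.coeff f i"
proof -
  have "Polynomial.coeff (lin_poly q f) (q ^ i) = (\<Sum>j\<le>degree f. if j = i then Polynomial.coeff f i else 0)"
    by (auto simp: lin_poly_def coeff_sum q_pow_inj intro!: sum.cong)
  then show ?thesis by (auto simp: coeff_eq_0)
qed

lemma lin_poly_nonzero: "(f :: 'b poly) \<noteq> 0 \<Longrightarrow> lin_poly q f \<noteq> 0"
  by (metis coeff_lin_poly coeff_0 leading_coeff_0_iff)

lemma degree_lin_poly: "(f :: 'b poly) \<noteq> 0 \<Longrightarrow> degree (lin_poly q f) = q ^ degree f"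
proof (rule antisym)
  show "degree (lin_poly q f) \<le> q ^ degree f"
    unfolding lin_poly_def
  proof (rule degree_sum_le)
    fix i assume "i \<in> {..degree f}"
    then have "q ^ i \<le> q ^ degree f" using q_pos by (auto intro: power_increasing)
    then show "degree (Polynomial.monom (Polynomial.coeff f i) (q ^ i)) \<le> q ^ degree f"
      using degree_monom_le order.trans by blast
  qed simp
  assume "f \<noteq> 0"
  then show "q ^ degree f \<le> degree (lin_poly q f)"
    by (intro le_degree) (simp add: coeff_lin_poly)
qed

lemma skew_ker_eq_roots: "skew_ker q (f :: 'b poly) = {x. poly (lin_poly q f) x = 0}"
  by (simp add: skew_ker_def poly_lin_poly)

lemma finite_skew_ker: "(f :: 'b poly) \<noteq> 0 \<Longrightarrow> finite (skew_ker q f)"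
  unfolding skew_ker_eq_roots by (intro poly_roots_finite lin_poly_nonzero)

lemma card_skew_ker_le: "(f :: 'b poly) \<noteq> 0 \<Longrightarrow> card (skew_ker q f) \<le> q ^ degree f"
  unfolding skew_ker_eq_roots using card_poly_roots_bound[OF lin_poly_nonzero] by (simp add: degree_lin_poly)

end


text \<open>That \<open>q\<close> vanishes in the field kills the derivatives of the powers with
  exponent \<open>q ^ i\<close>, \<open>i > 0\<close>; algebraic closedness provides all
  roots.\<close>

locale frobenius_closed = frobenius q F for q and F :: "'b::alg_closed_field itself" +
  assumes of_nat_q: "of_nat q = (0 :: 'b)"
begin

lemma pderiv_lin_poly: "pderiv (lin_poly q (f :: 'b poly)) = [:Polynomial.coeff f 0:]"
proof -
  have pd_sum: "pderiv (sum g A) = (\<Sum>i\<in>A. pderiv (g i))" for g :: "nat \<Rightarrow> 'b poly" and A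
    using higher_pderiv_sum[of 1 g A] by simp
  have "pderiv (lin_poly q f) = (\<Sum>i\<le>degree f. if i = 0 then [:Polynomial.coeff f 0:] else 0)"
    unfolding lin_poly_def pd_sum
  proof (rule sum.cong[OF refl])
    fix i
    show "pderiv (Polynomial.monom (Polynomial.coeff f i) (q ^ i)) = (if i = 0 then [:Polynomial.coeff f 0:] else 0)"
      by (cases i) (simp_all add: pderiv_monom monom_0 of_nat_q)
  qed
  then show ?thesis by simp
qed

text \<open>The derivative of the linearized polynomial is the nonzero constant coefficient, so
  there are as many roots as its degree \<open>q ^ degree f\<close>.\<close>

lemma card_skew_ker:
  assumes "Polynomial.coeff (f :: 'b poly) 0 \<noteq> 0"
  shows "card (skew_ker q f) = q ^ degree f"
proof -
  have f: "f \<noteq> 0" using assms by auto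
  show ?thesis
    unfolding skew_ker_eq_roots degree_lin_poly[OF f, symmetric]
    by (rule card_roots_separable[OF lin_poly_nonzero[OF f]]) (simp add: pderiv_lin_poly assms)
qed

text \<open>
  If \<open>w\<close> is not in the kernel of \<open>G\<close>, then \<open>(\<tau> - a\<^sup>q\<^sup>-\<^sup>1) G\<close> with \<open>a = G(w)\<close> has the kernel
  \<open>ker G + \<F>\<^sub>q w\<close>.
\<close>

lemma ex_skew_ker_eq:
  assumes fin: "finite U" and "0 \<in> U" and U_add: "\<And>x y. x \<in> U \<Longrightarrow> y \<in> U \<Longrightarrow> x + y \<in> U"
    and U_scale: "\<And>c x. c ^ q = c \<Longrightarrow> x \<in> U \<Longrightarrow> c * x \<in> U"
  obtains G :: "'b poly" where "lead_coeff G = 1" "Polynomial.coeff G 0 \<noteq> 0" "skew_ker q G = U"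
proof -
  let ?P = "\<lambda>G :: 'b poly. lead_coeff G = 1 \<and> Polynomial.coeff G 0 \<noteq> 0 \<and> skew_ker q G \<subseteq> U"
  \<comment> \<open>Kernels inside \<open>U\<close> bound the degree, so a candidate of largest
    degree exists; enlarging its kernel by a missing \<open>w\<close> would contradict
    maximality.\<close>
  have bound: "degree G < card U" if "?P G" for G
  proof -
    have "degree G < q ^ degree G"
      using q_gt_1 power_gt_expt by simp
    also have "\<dots> = card (skew_ker q G)" using card_skew_ker[of G] that by simp
    also have "\<dots> \<le> card U" using card_mono[OF fin] that by simp
    finally show ?thesis .
  qed
  have P1: "?P 1"
    using \<open>0 \<in> U\<close> by (auto simp: skew_ker_def)
  define G where "G = arg_max degree ?P"
  have "?P G \<and> (\<forall>H. ?P H \<longrightarrow> degree H \<le> degree G)"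
    unfolding G_def by (rule arg_max_nat_lemma[where P = ?P and k = 1 and b = "card U"]) (use P1 bound in blast)+
  then have G: "?P G" and max: "\<And>H. ?P H \<Longrightarrow> degree H \<le> degree G"
    by (blast, blast)
  have "U \<subseteq> skew_ker q G"
  proof
    fix w assume w: "w \<in> U"
    show "w \<in> skew_ker q G"
    proof (rule ccontr)
      assume "w \<notin> skew_ker q G"
      define a where "a = skew_eval q G w"
      have a: "a \<noteq> 0" using \<open>w \<notin> skew_ker q G\<close> by (simp add: a_def skew_ker_def)
      define H where "H = [:- (a ^ (q - 1)), 1:] \<star> G"
      have aq: "a ^ q = a ^ (q - 1) * a"
        using q_pos power_minus_mult[of q a] by simp
      have eval: "skew_eval q H x = (skew_eval q G x) ^ q - a ^ (q - 1) * skew_eval q G x" for x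
        unfolding H_def skew_eval_mult by (simp add: skew_eval_def)
      have "skew_ker q H \<subseteq> U"
      proof
        fix x assume "x \<in> skew_ker q H"
        \<comment> \<open>That \<open>H\<close> kills \<open>x\<close> says exactly that
          \<open>c\<close> is fixed by Frobenius. Then \<open>c * w\<close> lies in \<open>U\<close>
          and \<open>x - c * w\<close> in the kernel of \<open>G\<close>.\<close>
        define c where "c = skew_eval q G x / a"
        have "(skew_eval q G x) ^ q = a ^ (q - 1) * skew_eval q G x"
          using \<open>x \<in> skew_ker q H\<close> eval[of x] by (simp add: skew_ker_def)
        then have c: "c ^ q = c"
          using a by (simp add: c_def power_divide aq)
        have "skew_eval q G (x - c * w) = 0"
          using a by (simp add: skew_eval_diff_right skew_eval_scale[OF c] flip: a_def) (simp add: c_def)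
        then have "x - c * w \<in> U" using G by (auto simp: skew_ker_def)
        from U_add[OF this U_scale[OF c w]] show "x \<in> U" by simp
      qed
      moreover have "G \<noteq> 0" using G by auto
      then have "degree H = Suc (degree G)"
        unfolding H_def by (subst degree_skew) auto
      moreover have "lead_coeff H = 1"
        using coeff_skew_top[of "[:- (a ^ (q - 1)), 1:]" G] G \<open>degree H = Suc (degree G)\<close>
        by (simp add: H_def)
      moreover have "Polynomial.coeff H 0 \<noteq> 0"
        using G a by (simp add: H_def coeff_0_skew)
      ultimately show False using max[of H] by auto
    qed
  qed
  with G that show ?thesis by blast
qed

end

section \<open>Torsion modules over \<open>\<F>\<^sub>q[T]\<close>\<close>

text \<open>Coefficients are used instead of \<open>degree f < n\<close> because
  \<open>degree 0 = 0\<close>: this set contains 0 also for \<open>n = 0\<close>, so the count below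
  holds for all \<open>n\<close>.\<close>

definition polys_below :: "nat \<Rightarrow> 'b::zero poly set" where
  "polys_below n = {f. \<forall>i\<ge>n. Polynomial.coeff f i = 0}"

lemma polys_below_0: "polys_below 0 = {0}"
  by (auto simp: polys_below_def poly_eq_iff)

lemma polys_below_Suc: "(polys_below (Suc n) :: 'b::zero poly set) = (\<lambda>(a, f). pCons a f) ` (UNIV \<times> polys_below n)"
proof (intro Set.set_eqI iffI)
  fix f :: "'b::zero poly"
  assume f: "f \<in> polys_below (Suc n)"
  obtain a g where "f = pCons a g" by (cases f)
  moreover from this f have "g \<in> polys_below n"
    by (force simp: polys_below_def)
  ultimately show "f \<in> (\<lambda>(a, f). pCons a f) ` (UNIV \<times> polys_below n)"
    by (intro image_eqI[of _ _ "(a, g)"]) auto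
qed (auto simp: polys_below_def coeff_pCons split: nat.split)

lemma card_polys_below: "card (polys_below n :: 'b::{zero,finite} poly set) = card (UNIV :: 'b set) ^ n"
  and finite_polys_below: "finite (polys_below n :: 'b::{zero,finite} poly set)"
proof (induction n)
  case (Suc n)
  have "inj_on (\<lambda>(a, f). pCons a f) (UNIV \<times> polys_below n :: ('b \<times> 'b poly) set)"
    by (auto simp: inj_on_def)
  then show "card (polys_below (Suc n) :: 'b poly set) = card (UNIV :: 'b set) ^ Suc n"
    and "finite (polys_below (Suc n) :: 'b poly set)"
    by (simp_all add: polys_below_Suc card_image card_cartesian_product Suc)
qed (simp_all add: polys_below_0)

lemma polys_below_iff: "f \<in> polys_below n \<longleftrightarrow> f = 0 \<or> degree f < n"
proof
  assume f: "f \<in> polys_below n"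
  show "f = 0 \<or> degree f < n"
  proof (rule ccontr)
    assume "\<not> ?thesis"
    with f have "lead_coeff f = 0" by (simp add: polys_below_def)
    with \<open>\<not> ?thesis\<close> show False by simp
  qed
qed (auto simp: polys_below_def coeff_eq_0)

lemma polys_below_diff: "f \<in> polys_below n \<Longrightarrow> g \<in> polys_below n \<Longrightarrow> f - g \<in> polys_below n"
  for f g :: "'b::ab_group_add poly"
  by (simp add: polys_below_def)

text \<open>A least-degree element \<open>d\<close> of the ideal generated by \<open>f\<close> and
  \<open>p\<close> divides both. By irreducibility it is a unit, since otherwise it would be
  associated to \<open>p\<close> and \<open>p\<close> would divide \<open>f\<close>.\<close>

lemma irreducible_bezout:
  fixes p f :: "'f::field poly"
  assumes p: "Factorial_Ring.irreducible p" and "\<not> p dvd f"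
  obtains a b where "a * f + b * p = 1"
proof -
  define I where "I = {a * f + b * p | a b. True}"
  have I_f: "f \<in> I" unfolding I_def by (rule CollectI, rule exI[of _ 1], rule exI[of _ 0]) simp
  have I_p: "p \<in> I" unfolding I_def by (rule CollectI, rule exI[of _ 0], rule exI[of _ 1]) simp
  have I_lin: "h - c * k \<in> I" if hk: "h \<in> I" "k \<in> I" for h k c
  proof -
    obtain x y z w where "h = x * f + y * p" "k = z * f + w * p"
      using hk unfolding I_def by blast
    then have "h - c * k = (x - c * z) * f + (y - c * w) * p"
      by (simp add: algebra_simps)
    then show ?thesis unfolding I_def by blast
  qed
  have p0: "p \<noteq> 0" using p by auto
  define d where "d = (ARG_MIN degree e. e \<in> I \<and> e \<noteq> 0)"
  have d: "d \<in> I" "d \<noteq> 0" and min: "\<And>e. e \<in> I \<Longrightarrow> e \<noteq> 0 \<Longrightarrow> degree d \<le> degree e"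
    using arg_min_nat_lemma[of "\<lambda>e. e \<in> I \<and> e \<noteq> 0" p degree] I_p p0 unfolding d_def by blast+
  have dvd: "d dvd h" if "h \<in> I" for h
  proof -
    have "h mod d \<in> I"
      using I_lin[OF that d(1), of "h div d"] by (simp add: minus_div_mult_eq_mod)
    then have "h mod d = 0"
      using min[of "h mod d"] degree_mod_less[OF d(2), of h] by (cases "h mod d = 0") auto
    then show ?thesis by (simp add: mod_eq_0_iff_dvd)
  qed
  obtain e where e: "p = d * e" using dvd[OF I_p] by (rule dvdE)
  have "\<not> e dvd 1"
  proof
    assume "e dvd 1"
    then have "p dvd d" using e by (simp add: mult_unit_dvd_iff)
    then show False using dvd[OF I_f] \<open>\<not> p dvd f\<close> dvd_trans by blast
  qed
  then have "d dvd 1" using Factorial_Ring.irreducibleD[OF p e] by blast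
  then obtain c where c: "1 = d * c" by (rule dvdE)
  obtain a b where "d = a * f + b * p" using d(1) unfolding I_def by blast
  then have "(c * a) * f + (c * b) * p = 1" using c by (simp add: algebra_simps)
  then show ?thesis by (rule that)
qed

text \<open>The list \<open>ps\<close> holds the irreducible factors of an annihilator. Their common
  degree \<open>m\<close> gives all simple quotients of a module killed by
  \<open>prod_list ps\<close> the same order.\<close>

locale poly_module = Modules.module scale
  for scale :: "'f::{field,finite} poly \<Rightarrow> 'b::ab_group_add \<Rightarrow> 'b" (infixr "*s" 75) +
  fixes m :: nat and ps :: "'f poly list"
  assumes irred: "\<And>p. p \<in> set ps \<Longrightarrow> Factorial_Ring.irreducible p"
    and deg: "\<And>p. p \<in> set ps \<Longrightarrow> degree p = m"
begin

text \<open>With \<open>w\<close> outside \<open>U\<close> and \<open>p *s w\<close> in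
  \<open>U\<close>, the submodule generated by \<open>U\<close> and \<open>w\<close> has a quotient
  by \<open>U\<close> isomorphic to the polynomials modulo \<open>p\<close>. The remainders of
  degree less than \<open>m\<close> count it.\<close>

lemma extend_submodule:
  assumes U: "subspace U" and W: "subspace W" and "U \<subset> W" and fin: "finite W"
    and kill: "\<And>x. x \<in> W \<Longrightarrow> prod_list ps *s x = 0"
  obtains U' where "subspace U'" "U \<subset> U'" "U' \<subseteq> W" "card U' = card U * card (UNIV :: 'f set) ^ m"
proof -
  \<comment> \<open>Multiply \<open>w\<close> by the factors one at a time, from the end of the
    list, until it enters \<open>U\<close>; the vector just before entry and the factor applied to
    it are the witnesses.\<close>
  have step: "\<exists>w\<in>W - U. \<exists>p\<in>set ps. p *s w \<in> U"
    if "w \<in> W - U" "prod_list ps' *s w \<in> U" "set ps' \<subseteq> set ps" for ps' w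
    using that
  proof (induction ps')
    case (Cons p ps')
    show ?case
    proof (cases "prod_list ps' *s w \<in> U")
      case False
      then have w': "prod_list ps' *s w \<in> W - U"
        using Cons.prems(1) subspace_scale[OF W] by simp
      have "p *s (prod_list ps' *s w) \<in> U" using Cons.prems(2) by simp
      then show ?thesis
        using Cons.prems(3) by (intro bexI[OF _ w'] bexI[of _ p]) auto
    qed (use Cons in auto)
  qed auto
  obtain w0 where "w0 \<in> W - U" using \<open>U \<subset> W\<close> by blast
  from step[OF this, of ps] obtain w p where w: "w \<in> W" "w \<notin> U" and p: "p \<in> set ps" "p *s w \<in> U"
    using kill subspace_0[OF U] \<open>w0 \<in> W - U\<close> by auto
  have p0: "p \<noteq> 0" using irred[OF p(1)] by auto
  define h where "h = (\<lambda>(u, f). u + f *s w)"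
  define U' where "U' = h ` (U \<times> polys_below m)"
  \<comment> \<open>The multiple of \<open>p\<close> in \<open>f\<close> contributes an element of
    \<open>U\<close>, so reducing \<open>f\<close> modulo \<open>p\<close> loses nothing and
    \<open>U'\<close> is closed under all scalars.\<close>
  have red: "u + f *s w \<in> U'" if u: "u \<in> U" for u f
  proof -
    have "f *s w = (f div p) *s (p *s w) + (f mod p) *s w"
      by (simp flip: scale_left_distrib)
    then have "u + f *s w = h (u + (f div p) *s (p *s w), f mod p)"
      by (simp add: h_def add.assoc)
    moreover have "f mod p \<in> polys_below m"
      using degree_mod_less[OF p0, of f] deg[OF p(1)] by (auto simp: polys_below_iff)
    moreover have "u + (f div p) *s (p *s w) \<in> U"
      using subspace_add[OF U u subspace_scale[OF U p(2)]] .
    ultimately show ?thesis unfolding U'_def by blast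
  qed
  have "subspace U'"
  proof (rule subspaceI)
    show "0 \<in> U'" using red[OF subspace_0[OF U], of 0] by simp
  next
    fix x y assume "x \<in> U'" "y \<in> U'"
    then obtain u f v g where "x = u + f *s w" "y = v + g *s w" "u \<in> U" "v \<in> U"
      by (auto simp: U'_def h_def)
    then show "x + y \<in> U'"
      using red[OF subspace_add[OF U], of u v "f + g"] by (simp add: scale_left_distrib algebra_simps)
  next
    fix c x assume "x \<in> U'"
    then obtain u f where "x = u + f *s w" "u \<in> U"
      by (auto simp: U'_def h_def)
    then show "c *s x \<in> U'"
      using red[OF subspace_scale[OF U], of u c "c * f"] by (simp add: scale_right_distrib)
  qed
  moreover have "U \<subseteq> U'"
    using red[of _ 0] by auto
  moreover have "w \<in> U'"
    using red[OF subspace_0[OF U], of 1] by simp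
  moreover have "U' \<subseteq> W"
    using subspace_add[OF W] subspace_scale[OF W w(1)] \<open>U \<subset> W\<close> by (auto simp: U'_def h_def)
  moreover have "inj_on h (U \<times> polys_below m)"
  proof (rule inj_onI; clarify)
    fix u f v g
    assume uv: "u \<in> U" "v \<in> U" and fg: "f \<in> polys_below m" "g \<in> polys_below m" and "h (u, f) = h (v, g)"
    then have eq: "(f - g) *s w = v - u"
      by (simp add: h_def scale_left_diff_distrib algebra_simps)
    \<comment> \<open>Otherwise \<open>f - g\<close>, of degree less than \<open>m\<close>, is
      coprime to \<open>p\<close>, and Bezout writes \<open>w\<close> through
      \<open>(f - g) *s w\<close> and \<open>p *s w\<close>, both in \<open>U\<close>.\<close>
    have "f - g = 0"
    proof (rule ccontr)
      assume "f - g \<noteq> 0"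
      then have "\<not> p dvd f - g"
        using polys_below_diff[OF fg] deg[OF p(1)] dvd_imp_degree_le[of p "f - g"]
        by (auto simp: polys_below_iff)
      then obtain a b where ab: "a * (f - g) + b * p = 1"
        using irreducible_bezout[OF irred[OF p(1)]] by blast
      have "w = (a * (f - g) + b * p) *s w" using ab by simp
      also have "\<dots> = a *s ((f - g) *s w) + b *s (p *s w)"
        by (simp only: scale_left_distrib scale_scale)
      also have "\<dots> \<in> U"
        unfolding eq by (intro subspace_add[OF U] subspace_scale[OF U] subspace_diff[OF U] uv p)
      finally show False using w by simp
    qed
    then show "u = v \<and> f = g" using eq by simp
  qed
  then have "card U' = card U * card (UNIV :: 'f set) ^ m"
    unfolding U'_def by (simp add: card_image card_cartesian_product card_polys_below)
  ultimately show ?thesis using that w by blast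
qed

lemma submodule_chain:
  assumes W: "subspace W" and fin: "finite W"
    and kill: "\<And>x. x \<in> W \<Longrightarrow> prod_list ps *s x = 0"
  obtains k where "card W = card (UNIV :: 'f set) ^ (m * k)"
    "\<And>j. j \<le> k \<Longrightarrow> \<exists>U. subspace U \<and> U \<subseteq> W \<and> card U = card (UNIV :: 'f set) ^ (m * j)"
proof -
  let ?c = "card (UNIV :: 'f set)"
  \<comment> \<open>The claim is relative to a lower end \<open>U\<close>, so that induction on the
    gap between \<open>U\<close> and \<open>W\<close> can pass to an extension of
    \<open>U\<close>.\<close>
  have "\<exists>k. card W = card U * ?c ^ (m * k) \<and>
      (\<forall>j\<le>k. \<exists>U'. subspace U' \<and> U' \<subseteq> W \<and> card U' = card U * ?c ^ (m * j))"
    if "subspace U" "U \<subseteq> W" for U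
    using that
  proof (induction "card W - card U" arbitrary: U rule: less_induct)
    case less
    show ?case
    proof (cases "U = W")
      case True
      then show ?thesis using W by (intro exI[of _ 0]) auto
    next
      case False
      then have "U \<subset> W" using less.prems by blast
      obtain V where V: "subspace V" "U \<subset> V" "V \<subseteq> W" "card V = card U * ?c ^ m"
        using extend_submodule[OF less.prems(1) W \<open>U \<subset> W\<close> fin kill] by blast
      have "card U < card V" "card V \<le> card W"
        using psubset_card_mono[of V U] card_mono[of W V] V fin finite_subset by blast+
      then have "card W - card V < card W - card U" by simp
      from less.hyps[OF this V(1,3)] obtain k where k: "card W = card V * ?c ^ (m * k)"
        "\<And>j. j \<le> k \<Longrightarrow> \<exists>U'. subspace U' \<and> U' \<subseteq> W \<and> card U' = card V * ?c ^ (m * j)"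
        by blast
      have "\<exists>U'. subspace U' \<and> U' \<subseteq> W \<and> card U' = card U * ?c ^ (m * j)" if "j \<le> Suc k" for j
      proof (cases j)
        case 0
        then show ?thesis using less.prems by auto
      next
        case (Suc i)
        then show ?thesis using k(2)[of i] that V(4) by (simp add: power_add mult_ac)
      qed
      then show ?thesis
        using k(1) V(4) by (intro exI[of _ "Suc k"]) (simp add: power_add mult_ac)
    qed
  qed
  from this[of "{0}"] show ?thesis
    using subspace_0[OF W] that by auto
qed

end


section \<open>Right divisors of \<open>\<Pi>\<close>\<close>

text \<open>
  Frobenius is additive on every extension \<open>'b\<close> of \<open>\<F>\<^sub>q\<close>: the polynomial \<open>(X + 1)\<^sup>q - X\<^sup>q - 1\<close> over
  \<open>\<F>\<^sub>q\<close> has degree less than \<open>q\<close> and vanishes on \<open>\<F>\<^sub>q\<close>.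
\<close>

lemma (in field_embedding) frobenius_power_card:
  assumes fin: "finite (UNIV :: 'k set)" and q: "card (UNIV :: 'k set) = q"
  shows "frobenius TYPE('b) q"
proof
  show q1: "1 < q"
    using card_mono[OF fin, of "{0, 1}"] q by simp
  have fix_k: "x ^ q = x" for x :: 'k
    using field_embedding.range_eq_fixed[of "\<lambda>x. x :: 'k", OF _ fin] q
    by (auto simp: field_embedding_def)
  define P :: "'k poly" where "P = [:1, 1:] ^ q - Polynomial.monom 1 q - 1"
  have "P = 0"
  proof (rule ccontr)
    assume "P \<noteq> 0"
    have "degree P \<le> q"
      unfolding P_def by (intro degree_diff_le) (simp_all add: degree_power_eq degree_monom_eq)
    moreover have "Polynomial.coeff P q = 0"
      using q1 lead_coeff_power[of "[:1, 1:] :: 'k poly" q]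
      by (simp add: P_def degree_power_eq coeff_1)
    ultimately have "degree P < q"
      using \<open>P \<noteq> 0\<close> by (metis le_neq_implies_less leading_coeff_0_iff)
    moreover have "{x. poly P x = 0} = UNIV"
      by (auto simp: P_def poly_monom fix_k)
    ultimately show False
      using card_poly_roots_bound[OF \<open>P \<noteq> 0\<close>] q by simp
  qed
  then have "[:1, 1:] ^ q = (Polynomial.monom 1 q + 1 :: 'k poly)"
    by (simp add: P_def algebra_simps)
  then have "map_poly h ([:1, 1:] ^ q) = map_poly h (Polynomial.monom 1 q + 1)"
    by simp
  moreover have "map_poly h (f ^ n) = map_poly h f ^ n" for f n
    by (induction n) (simp_all add: map_mult)
  ultimately have "map_poly h [:1, 1:] ^ q = Polynomial.monom 1 q + 1"
    by (simp add: map_add map_poly_monom)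
  then have eq: "[:1, 1:] ^ q = (Polynomial.monom 1 q + 1 :: 'b poly)"
    by (simp add: map_poly_pCons)
  fix x y :: 'b
  show "(x + y) ^ q = x ^ q + y ^ q"
  proof (cases "y = 0")
    case False
    have "poly ([:1, 1:] ^ q) (x / y) = poly (Polynomial.monom 1 q + 1) (x / y)"
      by (simp only: eq)
    then have "(1 + x / y) ^ q = (x / y) ^ q + 1"
      by (simp add: poly_monom)
    then have "y ^ q * (1 + x / y) ^ q = y ^ q * ((x / y) ^ q + 1)"
      by simp
    then show ?thesis
      using False by (simp add: algebra_simps flip: power_mult_distrib)
  qed (use q1 in simp)
qed

text \<open>Translation by 1 permutes the ring; comparing the sums of all elements leaves the
  cardinality as 0.\<close>

lemma of_nat_card_eq_0: "of_nat (card (UNIV :: 'k set)) = (0 :: 'k::{ring_1,finite})"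
proof -
  have "(\<Sum>x\<in>UNIV. x) = (\<Sum>x\<in>UNIV. x + 1 :: 'k)"
    by (rule sum.reindex_bij_witness[of _ "\<lambda>x. x + 1" "\<lambda>x. x - 1"]) auto
  then show ?thesis by (simp add: sum.distrib)
qed

lemma skew_tau_pow: "0 < q \<Longrightarrow> skew_tau [^]\<^bsub>skew_ring q\<^esub> n = (Polynomial.monom 1 n :: 'b::field poly)"
proof (induction n)
  case (Suc n)
  have "skew_mult q (Polynomial.monom 1 n) (Polynomial.monom 1 1) = (Polynomial.monom 1 n * Polynomial.monom 1 1 :: 'b poly)"
    by (rule skew_mult_eq_mult) (use Suc in auto)
  with Suc show ?case
    by (simp add: nat_pow_def skew_ring_def skew_tau_def mult_monom)
qed (simp add: nat_pow_def skew_ring_def)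

lemma monom_pow_skew_ring:
  "0 < q \<Longrightarrow> (Polynomial.monom 1 n :: 'b::field poly) [^]\<^bsub>skew_ring q\<^esub> k = Polynomial.monom 1 (n * k)"
proof (induction k)
  case (Suc k)
  have "skew_mult q (Polynomial.monom 1 (n * k)) (Polynomial.monom 1 n) = (Polynomial.monom 1 (n * k) * Polynomial.monom 1 n :: 'b poly)"
    by (rule skew_mult_eq_mult) (use Suc in auto)
  with Suc show ?case
    by (simp add: nat_pow_def skew_ring_def mult_monom add.commute)
qed (simp add: nat_pow_def skew_ring_def)

section \<open>The setting and the central skew polynomials coming from the small field\<close>

locale skew_crt =
  fixes q r m l :: nat
    and \<iota> :: "'f::{field,finite} \<Rightarrow> 'a::{field,finite}"
    and qs :: "'f poly list"
  assumes card_f: "card (UNIV :: 'f set) = q" and card_a: "card (UNIV :: 'a set) = q ^ r"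
    and emb: "field_embedding \<iota>"
    and r_pos: "1 \<le> r" and m_pos: "1 \<le> m" and l_pos: "1 \<le> l"
    and len: "length qs = l" and dist: "distinct qs"
    and qs_props: "\<And>f. f \<in> set qs \<Longrightarrow>
      lead_coeff f = 1 \<and> Factorial_Ring.irreducible f \<and> degree f = m \<and> f \<noteq> [:0, 1:]"
begin

abbreviation E :: "'f poly \<Rightarrow> 'a poly" where
  "E \<equiv> eval_tau_pow q r \<iota>"

abbreviation Qs :: "'a poly list" where
  "Qs \<equiv> map E qs"

abbreviation PI :: "'a poly" where
  "PI \<equiv> Pi_poly q Qs"

abbreviation lift :: "'a poly \<Rightarrow> 'a alg_closure poly" where
  "lift \<equiv> map_poly to_ac"

sublocale iota: field_embedding \<iota>
  by (rule emb)

sublocale ac: field_embedding "to_ac :: 'a \<Rightarrow> 'a alg_closure"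
  by (rule field_embedding_to_ac)

sublocale iac: field_embedding "\<lambda>x. to_ac (\<iota> x) :: 'a alg_closure"
  by (rule field_embedding_comp[OF emb field_embedding_to_ac])

sublocale K: frobenius q "TYPE('a)"
  by (rule iota.frobenius_power_card[OF finite card_f])

sublocale AC: frobenius_closed q "TYPE('a alg_closure)"
proof -
  interpret frobenius q "TYPE('a alg_closure)"
    by (rule iac.frobenius_power_card[OF finite card_f])
  show "frobenius_closed TYPE('a alg_closure) q"
  proof
    have "of_nat q = (0 :: 'f)"
      using of_nat_card_eq_0[where 'k = 'f] card_f by simp
    then show "of_nat q = (0 :: 'a alg_closure)"
      using iac.h_of_nat[of q] by simp
  qed
qed

lemma iota_frob: "\<iota> c ^ q = \<iota> c"
  using iota.range_eq_fixed[OF finite] card_f by blast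

text \<open>Powers of \<open>skew_tau\<close> multiply like those of a variable, so evaluation is
  ordinary substitution of \<open>X ^ r\<close>. Hence \<open>E\<close> is a homomorphism for the
  commutative product.\<close>

lemma E_eq: "E f = pcompose (map_poly \<iota> f) (Polynomial.monom 1 r)"
proof -
  have "pcompose (map_poly \<iota> f) (Polynomial.monom 1 r) =
      (\<Sum>j\<le>degree f. [:\<iota> (Polynomial.coeff f j):] * Polynomial.monom 1 r ^ j)"
    unfolding pcompose_altdef poly_altdef
    by (simp add: degree_map_poly coeff_map_poly)
  then show ?thesis
    by (simp add: eval_tau_pow_def skew_tau_pow monom_pow_skew_ring K.q_pos monom_power)
qed

lemma E_mult: "E (f * g) = E f * E g"
  by (simp add: E_eq iota.map_mult pcompose_mult)

lemma E_add: "E (f + g) = E f + E g"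
  by (simp add: E_eq iota.map_add pcompose_add)

lemma E_1: "E 1 = 1"
  by (simp add: E_eq pcompose_1)

lemma degree_E: "degree (E f) = degree f * r"
  by (simp add: E_eq degree_pcompose degree_monom_eq)

lemma coeff_E: "Polynomial.coeff (E f) i = (if r dvd i then \<iota> (Polynomial.coeff f (i div r)) else 0)"
proof -
  have "Polynomial.coeff (E f) i = (\<Sum>j\<le>degree f. if i = r * j then \<iota> (Polynomial.coeff f j) else 0)"
    by (auto simp: eval_tau_pow_def skew_tau_pow monom_pow_skew_ring K.q_pos coeff_sum intro!: sum.cong)
  also have "\<dots> = (\<Sum>j\<le>degree f. if j = i div r then (if r dvd i then \<iota> (Polynomial.coeff f j) else 0) else 0)"
    using r_pos by (intro sum.cong) auto
  also have "\<dots> = (if r dvd i then \<iota> (Polynomial.coeff f (i div r)) else 0)"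
    by (auto simp: coeff_eq_0)
  finally show ?thesis .
qed

lemma coeff_E_frob: "Polynomial.coeff (E f) i ^ q = Polynomial.coeff (E f) i"
  using K.q_pos by (simp add: coeff_E iota_frob)

lemma frob_r: "(x :: 'a) ^ (q ^ r) = x"
  using field_embedding.range_eq_fixed[of "\<lambda>x. x :: 'a"] card_a
  by (auto simp: field_embedding_def)

text \<open>Only exponents divisible by \<open>r\<close> occur in \<open>E f\<close>, and the
  corresponding Frobenius powers are trivial on \<open>'a\<close>. Together with
  \<open>skew_E_right\<close>, where the coefficients are fixed by Frobenius, this gives
  centrality.\<close>

lemma skew_E_left: "skew_mult q (E f) g = E f * g"
proof (rule skew_mult_eq_mult[OF K.q_pos])
  fix i j
  have "(x :: 'a) ^ (q ^ (r * k)) = x" for x k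
    by (induction k) (simp_all add: power_add power_mult frob_r)
  then show "Polynomial.coeff (E f) i = 0 \<or> Polynomial.coeff g j ^ q ^ i = Polynomial.coeff g j"
    by (auto simp: coeff_E)
qed

lemma skew_E_right: "skew_mult q g (E f) = g * E f"
  by (rule skew_mult_eq_mult[OF K.q_pos]) (simp add: K.fixed_pow[OF coeff_E_frob])

lemma PI_eq: "PI = E (prod_list qs)"
proof -
  have "Pi_poly q (map E fs) = E (prod_list fs)" for fs
    by (induction fs) (simp_all add: Pi_poly_def E_1 skew_E_left E_mult)
  then show ?thesis .
qed

lemma qs_nonzero: "f \<in> set qs \<Longrightarrow> f \<noteq> 0"
  using qs_props[of 0] by auto

lemma degree_prod_list: "(\<And>f. f \<in> set fs \<Longrightarrow> f \<noteq> (0 :: 'f poly) \<and> degree f = m) \<Longrightarrow>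
    degree (prod_list fs) = length fs * m"
proof (induction fs)
  case (Cons f fs)
  then have "prod_list fs \<noteq> 0" by (auto simp: prod_list_zero_iff)
  with Cons show ?case by (simp add: degree_mult_eq)
qed simp

lemma degree_PI: "degree PI = m * l * r"
  using degree_prod_list[of qs] qs_props qs_nonzero len by (simp add: PI_eq degree_E)

lemma PI_nonzero: "PI \<noteq> 0"
  using degree_PI r_pos m_pos l_pos by auto

text \<open>A monic irreducible polynomial vanishing at 0 is the variable itself, which is excluded.
  So \<open>PI\<close> and its right divisors act separably.\<close>

lemma coeff_PI_0: "Polynomial.coeff PI 0 \<noteq> 0"
proof -
  have "Polynomial.coeff f 0 \<noteq> 0" if "f \<in> set qs" for f
  proof
    assume "Polynomial.coeff f 0 = 0"
    then obtain g where g: "f = [:0, 1:] * g"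
      by (cases f) auto
    have "\<not> [:0, 1:] dvd (1 :: 'f poly)"
      by (simp add: is_unit_iff_degree)
    then have "g dvd 1"
      using qs_props[OF that] Factorial_Ring.irreducibleD[OF _ g] by blast
    then have "degree g = 0"
      using is_unit_iff_degree[of g] by force
    then obtain c where "g = [:c:]"
      by (rule degree_eq_zeroE)
    then have "f = [:0, 1:]"
      using g qs_props[OF that] by (cases "c = 0") auto
    then show False using qs_props[OF that] by blast
  qed
  then have "Polynomial.coeff (prod_list fs) 0 \<noteq> 0" if "set fs \<subseteq> set qs" for fs
    using that by (induction fs) (auto simp: coeff_mult)
  then show ?thesis by (simp add: PI_eq coeff_E)
qed

lemma right_dvd_PI_coeff_0:
  assumes "right_dvd q G PI"
  shows "Polynomial.coeff G 0 \<noteq> 0"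
  using assms coeff_PI_0 by (auto simp: right_dvd_def K.coeff_0_skew)

section \<open>The module structure on the algebraic closure\<close>

definition act :: "'f poly \<Rightarrow> 'a alg_closure \<Rightarrow> 'a alg_closure" where
  "act f x = skew_eval q (lift (E f)) x"

lemma eval_lift_skew: "skew_eval q (lift (skew_mult q f g)) x = skew_eval q (lift f) (skew_eval q (lift g) x)"
  by (simp add: ac.map_skew[OF K.q_pos] AC.skew_eval_mult)

text \<open>Centrality of \<open>E f\<close> makes every skew operator over \<open>'a\<close>
  commute with \<open>act f\<close>; this is why kernels are submodules.\<close>

lemma eval_lift_E: "skew_eval q (lift g) (act f x) = act f (skew_eval q (lift g) x)"
  unfolding act_def by (simp only: skew_E_left skew_E_right mult.commute flip: eval_lift_skew)

sublocale M: poly_module act m qs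
proof (unfold_locales)
  show "act f (x + y) = act f x + act f y" for f x y
    by (simp add: act_def AC.skew_eval_add_right)
  show "act (f + g) x = act f x + act g x" for f g x
    by (simp add: act_def E_add ac.map_add AC.skew_eval_add)
  show "act f (act g x) = act (f * g) x" for f g x
    by (simp add: act_def E_mult flip: eval_lift_skew skew_E_left)
  show "act 1 x = x" for x
    by (simp add: act_def E_1)
qed (use qs_props in auto)

lemma subspace_ker: "M.subspace (skew_ker q (lift G))"
proof (rule M.subspaceI)
  fix f x assume "x \<in> skew_ker q (lift G)"
  then show "act f x \<in> skew_ker q (lift G)"
    by (simp add: skew_ker_def eval_lift_E)
qed (simp_all add: skew_ker_def AC.skew_eval_add_right)

lemma act_prod: "act (prod_list qs) x = skew_eval q (lift PI) x"
  by (simp add: act_def PI_eq)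

text \<open>With \<open>act_const\<close>, this shows that a submodule is stable under the
  \<open>q ^ r\<close>-Frobenius and under scalars from the small field, as needed to find its
  annihilator with coefficients in \<open>'a\<close>.\<close>

lemma act_X: "act [:0, 1:] x = x ^ (q ^ r)"
  by (simp add: act_def E_eq map_poly_pCons pcompose_pCons map_poly_monom AC.skew_eval_monom)

lemma act_const: "act [:c:] x = to_ac (\<iota> c) * x"
  by (simp add: act_def E_eq map_poly_pCons skew_eval_def)

text \<open>The kernel of \<open>G\<close> is a submodule killed by the product of
  \<open>qs\<close>, so its order is a power of \<open>q ^ m\<close>; by separability it is also
  \<open>q ^ degree G\<close>.\<close>

lemma dvd_degree_right_divisor:
  assumes "right_dvd q G PI"
  shows "m dvd degree G"
proof -
  have G: "Polynomial.coeff G 0 \<noteq> 0" by (rule right_dvd_PI_coeff_0[OF assms])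
  let ?W = "skew_ker q (lift G)"
  have fin: "finite ?W"
    using G by (intro AC.finite_skew_ker) auto
  obtain B where B: "PI = skew_mult q B G" using assms by (auto simp: right_dvd_def)
  have "act (prod_list qs) x = 0" if "x \<in> ?W" for x
    using that by (simp add: act_prod B eval_lift_skew skew_ker_def)
  from M.submodule_chain[OF subspace_ker fin this] obtain k where "card ?W = q ^ (m * k)"
    unfolding card_f by blast
  moreover have "card ?W = q ^ degree G"
    using AC.card_skew_ker[of "lift G"] G by simp
  ultimately show ?thesis by (simp add: AC.q_pow_inj)
qed

text \<open>Take a submodule \<open>U\<close> of the kernel of \<open>PI\<close> of order
  \<open>q ^ (m * j)\<close> and its monic annihilator \<open>G\<close> over the closure. Frobenius
  stability of \<open>U\<close> brings the coefficients of \<open>G\<close> down to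
  \<open>'a\<close>, and right division shows that \<open>G\<close> divides
  \<open>PI\<close>.\<close>

lemma ex_monic_right_divisor:
  assumes "j \<le> l * r"
  obtains G where "lead_coeff G = 1" "right_dvd q G PI" "degree G = m * j"
proof -
  let ?W = "skew_ker q (lift PI)"
  let ?s = "\<lambda>c :: 'a alg_closure. c ^ (q ^ r)"
  have fin: "finite ?W"
    using PI_nonzero by (intro AC.finite_skew_ker) auto
  have "act (prod_list qs) x = 0" if "x \<in> ?W" for x
    using that by (simp add: act_prod skew_ker_def)
  from M.submodule_chain[OF subspace_ker fin this] obtain k where k: "card ?W = q ^ (m * k)"
    and sub: "\<And>j. j \<le> k \<Longrightarrow> \<exists>U. M.subspace U \<and> U \<subseteq> ?W \<and> card U = q ^ (m * j)"
    unfolding card_f by blast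
  have "card ?W = q ^ degree PI"
    using AC.card_skew_ker[of "lift PI"] coeff_PI_0 by simp
  then have "m * k = m * l * r"
    using k by (simp add: AC.q_pow_inj degree_PI)
  then have "k = l * r" using m_pos by simp
  with sub assms obtain U where U: "M.subspace U" "U \<subseteq> ?W" "card U = q ^ (m * j)"
    by blast
  have finU: "finite U" using U fin finite_subset by blast
  have scale: "c * x \<in> U" if c: "c ^ q = c" and x: "x \<in> U" for c x
  proof -
    obtain d where "c = to_ac (\<iota> d)"
      using c iac.range_eq_fixed[OF finite] unfolding card_f by blast
    then show ?thesis
      using M.subspace_scale[OF U(1) x, of "[:d:]"] by (simp add: act_const)
  qed
  obtain G where G: "lead_coeff G = 1" "Polynomial.coeff G 0 \<noteq> 0" "skew_ker q G = U"
    using AC.ex_skew_ker_eq[OF finU M.subspace_0[OF U(1)] M.subspace_add[OF U(1)] scale] by blast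
  have degG: "degree G = m * j"
    using AC.card_skew_ker[OF G(2)] G(3) U(3) by (simp add: AC.q_pow_inj)
  have G0: "G \<noteq> 0" using G(1) by auto
  \<comment> \<open>The conjugate of \<open>G\<close> annihilates the image of \<open>U\<close>
    under the \<open>q ^ r\<close>-Frobenius. That image is \<open>U\<close>, since \<open>U\<close>
    is finite and the map is injective and preserves \<open>U\<close>.\<close>
  define H where "H = map_poly ?s G"
  have coeff_H: "Polynomial.coeff H i = ?s (Polynomial.coeff G i)" for i
    by (simp add: H_def coeff_map_poly)
  have degH: "degree H = degree G"
    unfolding H_def by (rule degree_map_poly) simp
  have eval_H: "skew_eval q H (?s x) = ?s (skew_eval q G x)" for x
  proof -
    have "?s x ^ (q ^ i) = ?s (x ^ (q ^ i))" for i
      by (simp add: mult.commute flip: power_mult)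
    then show ?thesis
      by (simp add: skew_eval_def degH coeff_H AC.frob_pow_sum power_mult_distrib)
  qed
  have "inj_on ?s U"
  proof (rule inj_onI)
    fix x y assume "?s x = ?s y"
    then have "?s (x - y) = 0" by (simp add: AC.frob_pow_diff)
    then show "x = y" by simp
  qed
  moreover have "?s ` U \<subseteq> U"
    using M.subspace_scale[OF U(1), of _ "[:0, 1:]"] by (auto simp: act_X)
  ultimately have sU: "?s ` U = U"
    using finU endo_inj_surj by blast
  have U_H: "U \<subseteq> skew_ker q H"
  proof
    fix y assume "y \<in> U"
    then obtain x where "x \<in> U" "y = ?s x" using sU by blast
    then show "y \<in> skew_ker q H"
      using G(3) eval_H[of x] AC.frob_pow_0[of r] by (auto simp del: AC.frob_pow_0 simp: skew_ker_def)
  qed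
  \<comment> \<open>Both are monic of the same degree, so a nonzero difference would have lower
    degree and too small a kernel to contain \<open>U\<close>.\<close>
  have "G - H = 0"
  proof (rule ccontr)
    assume nz: "G - H \<noteq> 0"
    have "degree (G - H) \<le> degree G" using degH by (simp add: degree_diff_le)
    moreover have "Polynomial.coeff (G - H) (degree G) = 0" using G(1) by (simp add: coeff_H)
    ultimately have "degree (G - H) < degree G"
      using nz by (metis le_neq_implies_less leading_coeff_0_iff)
    then have "card (skew_ker q (G - H)) < card U"
      using AC.card_skew_ker_le[OF nz] AC.card_skew_ker[OF G(2)] G(3)
        power_strict_increasing[OF _ AC.q_gt_1] by (metis order.strict_trans1)
    moreover have "U \<subseteq> skew_ker q (G - H)"
      using U_H G(3) by (auto simp: skew_ker_def AC.skew_eval_diff)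
    then have "card U \<le> card (skew_ker q (G - H))"
      by (rule card_mono[OF AC.finite_skew_ker[OF nz]])
    ultimately show False by simp
  qed
  then have "?s (Polynomial.coeff G i) = Polynomial.coeff G i" for i
    using coeff_H[of i] by simp
  then have "Polynomial.coeff G i \<in> range to_ac" for i
    unfolding ac.range_eq_fixed[OF finite] card_a by simp
  then have of_ac: "to_ac (of_ac (Polynomial.coeff G i)) = Polynomial.coeff G i" for i
    by (rule to_ac_of_ac)
  define G0 where "G0 = map_poly of_ac G"
  have lift: "lift G0 = G"
    by (rule poly_eqI) (simp add: G0_def coeff_map_poly of_ac)
  have deg0: "degree G0 = degree G" using lift ac.degree_map by metis
  have nz: "G0 \<noteq> 0" using lift G0 by auto
  have "to_ac (lead_coeff G0) = 1"
    using G(1) deg0 lift ac.coeff_map by metis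
  then have lc: "lead_coeff G0 = 1" by simp
  obtain B R where BR: "PI = skew_mult q B G0 + R" "R = 0 \<or> degree R < degree G0"
    by (rule K.right_division[OF nz])
  have U_R: "U \<subseteq> skew_ker q (lift R)"
  proof
    fix x assume "x \<in> U"
    then have "skew_eval q (lift PI) x = 0" "skew_eval q (lift G0) x = 0"
      using U(2) G(3) lift by (auto simp: skew_ker_def)
    then show "x \<in> skew_ker q (lift R)"
      by (simp add: BR(1) ac.map_add AC.skew_eval_add eval_lift_skew skew_ker_def)
  qed
  \<comment> \<open>The remainder also kills \<open>U\<close>, whose \<open>q ^ degree G0\<close>
    elements are too many for a nonzero skew polynomial of lower degree.\<close>
  have "R = 0"
  proof (rule ccontr)
    assume "R \<noteq> 0"
    then have "card (skew_ker q (lift R)) < card U"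
      using AC.card_skew_ker_le[of "lift R"] AC.card_skew_ker[OF G(2)] G(3) BR(2) deg0
        power_strict_increasing[OF _ AC.q_gt_1] by (metis order.strict_trans1 ac.degree_map ac.map_eq_0_iff)
    moreover have "card U \<le> card (skew_ker q (lift R))"
      using U_R \<open>R \<noteq> 0\<close> by (intro card_mono AC.finite_skew_ker) auto
    ultimately show False by simp
  qed
  then have "right_dvd q G0 PI" using BR by (auto simp: right_dvd_def)
  with lc deg0 degG that show ?thesis by simp
qed

end

section \<open>The Chinese remainder map\<close>

lemma (in frobenius) ring_skew_ring: "ring (skew_ring q :: 'b poly ring)"
proof (rule ringI)
  show "abelian_group (skew_ring q :: 'b poly ring)"
  proof (rule abelian_groupI)
    fix x :: "'b poly"
    show "\<exists>y\<in>carrier (skew_ring q). y \<oplus>\<^bsub>skew_ring q\<^esub> x = \<zero>\<^bsub>skew_ring q\<^esub>"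
      by (rule bexI[of _ "- x"]) (simp_all add: skew_ring_def)
  qed (simp_all add: skew_ring_def add.assoc add.commute)
  show "monoid (skew_ring q :: 'b poly ring)"
    by (rule monoidI) (simp_all add: skew_ring_def skew_assoc)
qed (simp_all add: skew_ring_def skew_add_left skew_add_right)

text \<open>Turns dimensions into cardinalities, so that the code bounds become counting
  arguments.\<close>

lemma (in ring) card_dimension:
  assumes K: "subfield K R" and fin: "finite K" and "dimension n K E"
  shows "finite E \<and> card E = card K ^ n"
  using assms(3,1,2)
proof (induction rule: dimension.induct)
  case (Suc_dim v E n K)
  note [simp] = \<open>v \<in> carrier R\<close>
  note props = space_subgroup_props[OF Suc_dim.prems(1) Suc_dim.hyps(3)]
  have K_carr: "k \<in> carrier R" if "k \<in> K" for k
    using subfieldE(3)[OF Suc_dim.prems(1)] that by blast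
  have E_carr: "u \<in> carrier R" if "u \<in> E" for u
    using props(1) that by blast
  have eq: "line_extension K v E = (\<lambda>(k, u). k \<otimes> v \<oplus> u) ` (K \<times> E)"
    by (auto simp: line_extension_mem_iff) blast
  have "inj_on (\<lambda>(k, u). k \<otimes> v \<oplus> u) (K \<times> E)"
  proof (rule inj_onI; clarify)
    fix k u k' u'
    assume k: "k \<in> K" "k' \<in> K" and u: "u \<in> E" "u' \<in> E" and eq: "k \<otimes> v \<oplus> u = k' \<otimes> v \<oplus> u'"
    note [simp] = K_carr[OF k(1)] K_carr[OF k(2)] E_carr[OF u(1)] E_carr[OF u(2)]
    let ?a = "k \<otimes> v" and ?b = "k' \<otimes> v"
    have "?b \<oplus> (?a \<ominus> ?b) = ?a"
      by (simp add: a_minus_def a_lcomm[of ?b ?a] r_neg)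
    then have "?b \<oplus> ((?a \<ominus> ?b) \<oplus> u) = ?b \<oplus> u'"
      unfolding eq[symmetric] by (simp flip: a_assoc)
    then have "(?a \<ominus> ?b) \<oplus> u = u'" by simp
    then have "u' \<ominus> u = ?a \<ominus> ?b"
      by (auto simp: a_minus_def a_assoc r_neg)
    \<comment> \<open>A nonzero \<open>k \<ominus> k'\<close> would put \<open>v\<close> into
      \<open>E\<close>, against the choice of \<open>v\<close> in the line extension.\<close>
    then have "(k \<ominus> k') \<otimes> v = u' \<ominus> u"
      by (simp add: a_minus_def l_distr l_minus)
    moreover have "u' \<ominus> u \<in> E"
      using u props(3,4) by (simp add: a_minus_def)
    ultimately have "(k \<ominus> k') \<otimes> v \<in> E" by simp
    moreover have "k \<ominus> k' \<in> K"
      using subringE(5,7)[OF subfieldE(1)[OF Suc_dim.prems(1)]] k by (simp add: a_minus_def)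
    ultimately have "k \<ominus> k' = \<zero>"
      using props(6)[of "k \<ominus> k'" v] Suc_dim.hyps(2) by auto
    then have "k = k'" by simp
    with eq show "k = k' \<and> u = u'" by simp
  qed
  then show ?case
    using Suc_dim by (simp add: eq card_image card_cartesian_product)
qed auto

text \<open>An upper bound suffices: injectivity of the remainder map supplies the reverse
  inequality.\<close>

lemma card_RDirProd_list_le:
  assumes "\<And>R. R \<in> set Rs \<Longrightarrow> finite (carrier R) \<and> card (carrier R) \<le> c"
  shows "finite (carrier (RDirProd_list Rs)) \<and> card (carrier (RDirProd_list Rs)) \<le> c ^ length Rs"
  using assms
proof (induction Rs)
  case (Cons R Rs)
  let ?A = "carrier R \<times> carrier (RDirProd_list Rs)"
  have fin: "finite ?A" using Cons by simp
  have "card ((\<lambda>(x, xs). x # xs) ` ?A) \<le> card ?A"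
    using fin by (rule card_image_le)
  also have "\<dots> \<le> c * c ^ length Rs"
    unfolding card_cartesian_product using Cons by (intro mult_le_mono) auto
  finally show ?case using fin by (simp add: RDirProd_list_carrier)
qed simp

context skew_crt
begin

abbreviation SR :: "'a poly ring" where
  "SR \<equiv> skew_ring q"

abbreviation PR :: "'a poly set list ring" where
  "PR \<equiv> prod_ring q Qs"

abbreviation crt :: "'a poly \<Rightarrow> 'a poly set list" where
  "crt \<equiv> CRT q Qs"

abbreviation N :: nat where
  "N \<equiv> degree PI"

lemma SR_simps [simp]:
  "carrier SR = UNIV" "monoid.mult SR = skew_mult q" "add SR = (+)" "zero SR = 0" "one SR = 1"
  by (simp_all add: skew_ring_def)

sublocale SR: ring SR
  by (rule K.ring_skew_ring)

text \<open>For central elements, left multiples are commutative multiples, so residue classes can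
  be handled with \<open>dvd\<close> and \<open>mod\<close>.\<close>

lemma PIdl_E: "PIdl\<^bsub>SR\<^esub> (E f) = {u. E f dvd u}"
  by (auto simp: cgenideal_def skew_E_right dvd_def mult.commute)

lemma ideal_E: "ideal (PIdl\<^bsub>SR\<^esub> (E f)) SR"
proof (rule idealI)
  show "ring SR" by (rule SR.ring_axioms)
  have minus: "\<ominus>\<^bsub>SR\<^esub> u = - u" for u
    using SR.minus_equality[of "- u" u] by simp
  show "subgroup (PIdl\<^bsub>SR\<^esub> (E f)) (add_monoid SR)"
    by (rule SR.add.subgroupI) (auto simp: PIdl_E minus simp flip: a_inv_def)
  fix a x assume "a \<in> PIdl\<^bsub>SR\<^esub> (E f)"
  then obtain b where b: "a = skew_mult q b (E f)" "a = skew_mult q (E f) b"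
    by (auto simp: PIdl_E skew_E_right skew_E_left dvd_def mult.commute)
  show "x \<otimes>\<^bsub>SR\<^esub> a \<in> PIdl\<^bsub>SR\<^esub> (E f)"
    using b(1) by (auto simp: cgenideal_def simp flip: K.skew_assoc)
  have "skew_mult q a x = E f * skew_mult q b x"
    unfolding b(2) K.skew_assoc by (rule skew_E_left)
  then show "a \<otimes>\<^bsub>SR\<^esub> x \<in> PIdl\<^bsub>SR\<^esub> (E f)"
    by (simp add: PIdl_E)
qed

lemma coset_E: "PIdl\<^bsub>SR\<^esub> (E f) +>\<^bsub>SR\<^esub> u = {v. E f dvd v - u}"
proof -
  have "v \<in> (\<lambda>h. h + u) ` {h. E f dvd h}" if "E f dvd v - u" for v
    using that by (intro image_eqI[of _ _ "v - u"]) auto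
  then show ?thesis
    by (auto simp: a_r_coset_def' PIdl_E)
qed

lemma coset_E_eq_iff:
  "PIdl\<^bsub>SR\<^esub> (E f) +>\<^bsub>SR\<^esub> u = PIdl\<^bsub>SR\<^esub> (E f) +>\<^bsub>SR\<^esub> v \<longleftrightarrow> E f dvd u - v"
proof
  assume "PIdl\<^bsub>SR\<^esub> (E f) +>\<^bsub>SR\<^esub> u = PIdl\<^bsub>SR\<^esub> (E f) +>\<^bsub>SR\<^esub> v"
  then have "u \<in> {w. E f dvd w - v}" unfolding coset_E by auto
  then show "E f dvd u - v" by simp
next
  assume uv: "E f dvd u - v"
  have "E f dvd w - u \<longleftrightarrow> E f dvd w - v" for w
    using dvd_add_right_iff[OF uv, of "w - u"] by simp
  then show "PIdl\<^bsub>SR\<^esub> (E f) +>\<^bsub>SR\<^esub> u = PIdl\<^bsub>SR\<^esub> (E f) +>\<^bsub>SR\<^esub> v"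
    unfolding coset_E by simp
qed

lemma crt_hom: "ring_hom_ring SR PR crt"
proof -
  define I where "I = (\<lambda>i. PIdl\<^bsub>SR\<^esub> (Qs ! i))"
  \<comment> \<open>\<open>canonical_proj_ext\<close> takes the last index rather than the number of
    ideals; \<open>l \<ge> 1\<close> makes its range the positions in \<open>Qs\<close>.\<close>
  have upt: "[0..<Suc (l - 1)] = [0..<length Qs]" using l_pos len by simp
  have map_upt: "map (\<lambda>i. g (Qs ! i)) [0..<length Qs] = map g Qs" for g :: "'a poly \<Rightarrow> 'c"
    by (rule nth_equalityI) auto
  have "ideal (I i) SR" if "i \<le> l - 1" for i
    using that l_pos len ideal_E[of "qs ! i"] by (simp add: I_def)
  then have "ring_hom_ring SR (RDirProd_list (map (\<lambda>i. SR Quot (I i)) [0..<Suc (l - 1)]))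
      (SR.canonical_proj_ext I (l - 1))"
    by (rule SR.canonical_proj_ext_ring_hom)
  moreover have "map (\<lambda>i. SR Quot (I i)) [0..<Suc (l - 1)] = map (\<lambda>Q. SR Quot (PIdl\<^bsub>SR\<^esub> Q)) Qs"
    unfolding upt I_def by (rule map_upt)
  moreover have "SR.canonical_proj_ext I (l - 1) = crt"
    unfolding SR.canonical_proj_ext_def CRT_def upt I_def
    by (rule ext) (rule map_upt[of "\<lambda>Q. PIdl\<^bsub>SR\<^esub> Q +>\<^bsub>SR\<^esub> a" for a])
  ultimately show ?thesis by (simp add: prod_ring_def)
qed

sublocale crt: ring_hom_ring SR PR crt
  by (rule crt_hom)

lemma crt_add: "crt (u + v) = crt u \<oplus>\<^bsub>PR\<^esub> crt v"
  using crt.hom_add[of u v] by simp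

lemma crt_mult: "crt (skew_mult q u v) = crt u \<otimes>\<^bsub>PR\<^esub> crt v"
  using crt.hom_mult[of u v] by simp

lemma crt_0: "crt 0 = \<zero>\<^bsub>PR\<^esub>"
  using crt.hom_zero by simp

lemma crt_1: "crt 1 = \<one>\<^bsub>PR\<^esub>"
  using crt.hom_one by simp

lemma crt_in_carrier [simp]: "crt u \<in> carrier PR"
  using crt.hom_closed[of u] by simp

text \<open>Distinct monic irreducible polynomials are coprime, and \<open>E\<close> carries their
  Bezout identities to the skew side. So divisibility by all factors amounts to divisibility by
  \<open>PI\<close>.\<close>

lemma crt_eq_iff: "crt u = crt v \<longleftrightarrow> PI dvd u - v"
proof -
  have bezout: "\<exists>a b. a * f + b * prod_list fs = 1"
    if f: "f \<in> set qs" and fs: "set fs \<subseteq> set qs" "f \<notin> set fs" for f fs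
    using fs
  proof (induction fs)
    case Nil
    show ?case by (rule exI[of _ 0], rule exI[of _ 1]) simp
  next
    case (Cons g fs)
    then obtain a b where ab: "a * f + b * prod_list fs = 1" by auto
    have g: "g \<in> set qs" "g \<noteq> f" using Cons.prems by auto
    have "\<not> f dvd g"
    proof
      assume "f dvd g"
      then obtain c where c: "g = f * c" by (rule dvdE)
      have "c \<noteq> 0" using c qs_nonzero[OF g(1)] by auto
      then have "degree c = 0"
        using c qs_props[OF g(1)] qs_props[OF f] qs_nonzero[OF f] degree_mult_eq[of f c] by simp
      moreover have "lead_coeff c = 1"
        using lead_coeff_mult[of f c, folded c] qs_props[OF g(1)] qs_props[OF f]
        by (metis mult_1)
      ultimately have "c = 1" by (auto elim!: degree_eq_zeroE)
      then show False using c g(2) by simp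
    qed
    then obtain x y where xy: "x * g + y * f = 1"
      using irreducible_bezout qs_props[OF f] by metis
    \<comment> \<open>Multiplying the two Bezout identities collects every term but the last into a
      multiple of \<open>f\<close>.\<close>
    have "(a * f + b * prod_list fs) * (x * g + y * f) = 1" using ab xy by simp
    then have "(a * x * g + a * y * f + b * y * prod_list fs) * f + (b * x) * prod_list (g # fs) = 1"
      by (simp add: algebra_simps)
    then show ?case by blast
  qed
  have "(\<forall>f\<in>set fs. E f dvd w) \<longleftrightarrow> E (prod_list fs) dvd w" if "set fs \<subseteq> set qs" "distinct fs" for fs w
    using that
  proof (induction fs)
    case (Cons f fs)
    obtain a b where "a * f + b * prod_list fs = 1"
      using bezout[of f fs] Cons.prems by auto
    then have ab: "E a * E f + E b * E (prod_list fs) = 1"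
      by (metis E_1 E_add E_mult)
    have both: "E f * E (prod_list fs) dvd w" if fw: "E f dvd w" "E (prod_list fs) dvd w"
    proof -
      \<comment> \<open>In each summand one factor is explicit and the other divides
        \<open>w\<close>.\<close>
      have "w = (E a * E f + E b * E (prod_list fs)) * w" by (simp only: ab mult_1)
      also have "\<dots> = E a * (E f * w) + E b * (E (prod_list fs) * w)"
        by (simp only: distrib_right mult.assoc)
      finally have w: "w = E a * (E f * w) + E b * (E (prod_list fs) * w)" .
      have "E f * E (prod_list fs) dvd E f * w"
        using fw(2) by (intro mult_dvd_mono) auto
      moreover have "E f * E (prod_list fs) dvd E (prod_list fs) * w"
        using mult_dvd_mono[OF dvd_refl fw(1), of "E (prod_list fs)"] by (simp add: mult.commute)
      ultimately have "E f * E (prod_list fs) dvd E a * (E f * w) + E b * (E (prod_list fs) * w)"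
        by (rule dvd_add[OF dvd_mult dvd_mult])
      then show ?thesis unfolding w[symmetric] .
    qed
    have "(\<forall>g\<in>set (f # fs). E g dvd w) \<longleftrightarrow> E f dvd w \<and> E (prod_list fs) dvd w"
      using Cons by simp
    also have "\<dots> \<longleftrightarrow> E f * E (prod_list fs) dvd w"
      using both dvd_mult_left[of "E f" "E (prod_list fs)" w] dvd_mult_right[of "E f" "E (prod_list fs)" w]
      by blast
    finally show ?case by (simp add: E_mult)
  qed (simp add: E_1)
  from this[of qs] dist show ?thesis
    by (auto simp: CRT_def coset_E_eq_iff PI_eq)
qed

lemma N_pos: "0 < N"
  using degree_PI r_pos m_pos l_pos by simp

lemma inj_on_crt: "inj_on crt (polys_below N)"
proof (rule inj_onI)
  fix u v assume uv: "u \<in> polys_below N" "v \<in> polys_below N" "crt u = crt v"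
  then have "PI dvd u - v" "u - v \<in> polys_below N"
    by (auto simp: crt_eq_iff polys_below_diff)
  then show "u = v"
    using dvd_imp_degree_le[of PI "u - v"] by (cases "u = v") (auto simp: polys_below_iff)
qed

lemma crt_eq_0_iff: "u \<in> polys_below N \<Longrightarrow> crt u = \<zero>\<^bsub>PR\<^esub> \<longleftrightarrow> u = 0"
  unfolding crt_0[symmetric] by (rule inj_on_eq_iff[OF inj_on_crt]) (simp_all add: polys_below_iff)

lemma card_polys_below_a: "card (polys_below n :: 'a poly set) = (q ^ r) ^ n"
  by (simp add: card_polys_below card_a)

text \<open>Surjectivity comes from counting: \<open>crt\<close> is injective on
  \<open>(q ^ r) ^ N\<close> polynomials, and the product ring has at most that many
  elements.\<close>

lemma carrier_PR: "carrier PR = crt ` polys_below N" "finite (carrier PR)" "card (carrier PR) = (q ^ r) ^ N"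
proof -
  have "finite (carrier R) \<and> card (carrier R) \<le> (q ^ r) ^ (m * r)"
    if R: "R \<in> set (map (\<lambda>Q. SR Quot (PIdl\<^bsub>SR\<^esub> Q)) Qs)" for R
  proof -
    obtain f where f: "f \<in> set qs" "R = SR Quot (PIdl\<^bsub>SR\<^esub> (E f))" using R by auto
    have deg: "degree (E f) = m * r" using qs_props[OF f(1)] by (simp add: degree_E)
    then have "E f \<noteq> 0" using m_pos r_pos by auto
    let ?c = "\<lambda>u. PIdl\<^bsub>SR\<^esub> (E f) +>\<^bsub>SR\<^esub> u"
    have sub: "carrier R \<subseteq> ?c ` polys_below (m * r)"
    proof
      fix x assume "x \<in> carrier R"
      then obtain u where "x = ?c u" by (auto simp: f(2) FactRing_def A_RCOSETS_def')
      also have "?c u = ?c (u mod E f)"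
        unfolding coset_E_eq_iff by (simp add: minus_mod_eq_mult_div)
      finally show "x \<in> ?c ` polys_below (m * r)"
        using degree_mod_less[OF \<open>E f \<noteq> 0\<close>, of u] deg by (auto simp: polys_below_iff)
    qed
    have "card (carrier R) \<le> card (?c ` polys_below (m * r))"
      by (rule card_mono[OF _ sub]) (simp add: finite_polys_below)
    also have "\<dots> \<le> (q ^ r) ^ (m * r)"
      using card_image_le[OF finite_polys_below, of ?c "m * r"] by (simp add: card_polys_below_a)
    finally show ?thesis
      using finite_subset[OF sub] by (simp add: finite_polys_below)
  qed
  from card_RDirProd_list_le[of "map (\<lambda>Q. SR Quot (PIdl\<^bsub>SR\<^esub> Q)) Qs", OF this]
  have fin: "finite (carrier PR)" and "card (carrier PR) \<le> ((q ^ r) ^ (m * r)) ^ l"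
    unfolding prod_ring_def using len by auto
  note this(2)
  also have "((q ^ r) ^ (m * r)) ^ l = (q ^ r) ^ N"
    by (simp add: degree_PI mult_ac flip: power_mult)
  finally have le: "card (carrier PR) \<le> card (crt ` polys_below N)"
    by (simp add: card_image[OF inj_on_crt] card_polys_below_a)
  show eq: "carrier PR = crt ` polys_below N"
    by (rule card_seteq[OF fin _ le, symmetric]) auto
  show "finite (carrier PR)" by (rule fin)
  show "card (carrier PR) = (q ^ r) ^ N"
    by (simp add: eq card_image[OF inj_on_crt] card_polys_below_a)
qed

lemma CRT_lift_crt: "Y \<in> polys_below N \<Longrightarrow> CRT_lift q Qs (crt Y) = Y"
  unfolding CRT_lift_def using inj_onD[OF inj_on_crt] N_pos
  by (intro the_equality) (auto simp: polys_below_iff)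

end

section \<open>Scalars and dimension\<close>

context skew_crt
begin

text \<open>The constants from \<open>S\<close> form a subfield of the skew ring, and a ring
  homomorphism to a nonzero ring carries it injectively to a subfield. Both scalar fields are
  instances.\<close>

lemma subfield_scalars:
  assumes S: "0 \<in> S" "1 \<in> S" "\<And>a b. a \<in> S \<Longrightarrow> b \<in> S \<Longrightarrow> a + b \<in> S" "\<And>a. a \<in> S \<Longrightarrow> - a \<in> S"
    "\<And>a b. a \<in> S \<Longrightarrow> b \<in> S \<Longrightarrow> a * b \<in> S" "\<And>a. a \<in> S \<Longrightarrow> inverse a \<in> S"
  shows "subfield (scalars q Qs S) PR" "card (scalars q Qs S) = card S"
proof -
  let ?K = "(\<lambda>a. [:a:]) ` S"
  have const_mult: "skew_mult q [:a:] [:b:] = [:a * b:]" for a b :: 'a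
    by (simp add: skew_mult_const_left K.q_pos)
  have minus: "\<ominus>\<^bsub>SR\<^esub> u = - u" for u
    using SR.minus_equality[of "- u" u] by simp
  have "subring ?K SR"
    using S by (intro SR.subringI) (auto simp: minus const_mult one_pCons)
  then have "subcring ?K SR"
    by (rule SR.subcringI) (auto simp: const_mult mult.commute)
  moreover have "Units (SR\<lparr>carrier := ?K\<rparr>) = ?K - {\<zero>\<^bsub>SR\<^esub>}"
  proof (intro Set.set_eqI iffI)
    fix u assume "u \<in> Units (SR\<lparr>carrier := ?K\<rparr>)"
    then show "u \<in> ?K - {\<zero>\<^bsub>SR\<^esub>}" by (auto simp: Units_def)
  next
    fix u assume "u \<in> ?K - {\<zero>\<^bsub>SR\<^esub>}"
    then obtain a where a: "a \<in> S" "a \<noteq> 0" "u = [:a:]" by auto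
    then show "u \<in> Units (SR\<lparr>carrier := ?K\<rparr>)"
      using S(6)[OF a(1)] by (auto simp: Units_def const_mult one_pCons intro!: bexI[of _ "inverse a"])
  qed
  ultimately have K: "subfield ?K SR"
    by (rule SR.subfieldI)
  have "\<one>\<^bsub>PR\<^esub> \<noteq> \<zero>\<^bsub>PR\<^esub>"
    unfolding crt_1[symmetric] using crt_eq_0_iff[of 1] N_pos by (simp add: polys_below_iff)
  note img = crt.img_is_subfield[OF K this]
  have scalars: "scalars q Qs S = crt ` ?K"
    by (simp add: scalars_def image_image)
  show "subfield (scalars q Qs S) PR"
    unfolding scalars by (rule img(2))
  have "card (crt ` ?K) = card ?K" by (rule card_image[OF img(1)])
  also have "\<dots> = card S" by (rule card_image) (simp add: inj_on_def)
  finally show "card (scalars q Qs S) = card S" unfolding scalars .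
qed

lemma subfield_Fq: "subfield (scalars q Qs (range \<iota>)) PR"
  and card_Fq: "card (scalars q Qs (range \<iota>)) = q"
proof -
  have 1: "1 \<in> range \<iota>" using iota.h_1 by (metis rangeI)
  have 0: "0 \<in> range \<iota>" using iota.h_0 by (metis rangeI)
  have inv: "inverse (\<iota> x) = \<iota> (inverse x)" for x
  proof (cases "x = 0")
    case False
    then have "\<iota> x * \<iota> (inverse x) = 1" by (simp flip: iota.h_mult)
    then show ?thesis by (rule inverse_unique)
  qed simp
  have "subfield (scalars q Qs (range \<iota>)) PR \<and> card (scalars q Qs (range \<iota>)) = card (range \<iota>)"
    by (intro conjI subfield_scalars 0 1)
      (auto simp: inv simp flip: iota.h_add iota.h_mult iota.h_minus)
  then show "subfield (scalars q Qs (range \<iota>)) PR" "card (scalars q Qs (range \<iota>)) = q"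
    by (simp_all add: card_image iota.inj_h card_f)
qed

lemma subfield_Fqr: "subfield (scalars q Qs UNIV) PR"
  and card_Fqr: "card (scalars q Qs UNIV) = q ^ r"
  using subfield_scalars[of UNIV] by (simp_all add: card_a)

lemma card_of_dimension:
  assumes "subfield F PR" "ring.dimension PR n F D"
  shows "card D = card F ^ n"
proof -
  have "finite F"
    using subfieldE(3)[OF assms(1)] carrier_PR(2) finite_subset by blast
  then show ?thesis using crt.S.card_dimension[OF assms(1) _ assms(2)] by blast
qed

text \<open>Each step adjoins the monomial of degree \<open>n\<close>; its left multiples by
  constants supply the new top coefficient, and injectivity of \<open>crt\<close> below
  \<open>N\<close> keeps it independent.\<close>

lemma dimension_crt_polys_below:
  "n \<le> N \<Longrightarrow> ring.dimension PR n (scalars q Qs UNIV) (crt ` polys_below n)"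
proof (induction n)
  case 0
  then show ?case using crt.S.dimension.zero_dim by (simp add: polys_below_0 crt_0)
next
  case (Suc n)
  let ?v = "Polynomial.monom 1 n :: 'a poly"
  have v: "?v \<in> polys_below N" using Suc.prems by (simp add: polys_below_def)
  have sub: "polys_below n \<subseteq> (polys_below N :: 'a poly set)"
    using Suc.prems by (auto simp: polys_below_def)
  have "?v \<notin> polys_below n" by (auto simp: polys_below_def)
  then have "crt ?v \<notin> crt ` polys_below n"
    using inj_on_image_mem_iff[OF inj_on_crt v sub] by simp
  then have "ring.dimension PR (Suc n) (scalars q Qs UNIV)
      (crt.S.line_extension (scalars q Qs UNIV) (crt ?v) (crt ` polys_below n))"
    using Suc by (intro crt.S.dimension.Suc_dim) auto
  moreover have "crt.S.line_extension (scalars q Qs UNIV) (crt ?v) (crt ` polys_below n) =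
      crt ` polys_below (Suc n)"
  proof -
    have crt_lin: "crt [:a:] \<otimes>\<^bsub>PR\<^esub> crt ?v \<oplus>\<^bsub>PR\<^esub> crt u = crt (Polynomial.monom a n + u)" for a u
      by (simp add: crt_add skew_mult_const_left K.q_pos smult_monom flip: crt_mult)
    have "\<exists>a u. f = Polynomial.monom a n + u \<and> u \<in> polys_below n" if "f \<in> polys_below (Suc n)" for f :: "'a poly"
      using that
      by (intro exI[of _ "Polynomial.coeff f n"] exI[of _ "f - Polynomial.monom (Polynomial.coeff f n) n"])
        (auto simp: polys_below_def)
    moreover have "Polynomial.monom a n + u \<in> polys_below (Suc n)" if "u \<in> polys_below n" for a and u :: "'a poly"
      using that by (auto simp: polys_below_def)
    ultimately have "polys_below (Suc n) = {Polynomial.monom a n + u | (a :: 'a) u. u \<in> polys_below n}"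
      by blast
    then show ?thesis
      unfolding scalars_def by (auto simp: crt.S.line_extension_mem_iff crt_lin) blast+
  qed
  ultimately show ?case by simp
qed

section \<open>Poly-skew weight\<close>

lemma wt_crt: "Y \<in> polys_below N \<Longrightarrow> wt_ps q Qs (crt Y) = N - degree (gcrd q PI Y)"
  by (simp add: wt_ps_def CRT_lift_crt)

lemma gcrd_PI:
  shows "lead_coeff (gcrd q PI Y) = 1" "right_dvd q (gcrd q PI Y) PI" "right_dvd q (gcrd q PI Y) Y"
    and "right_dvd q G PI \<Longrightarrow> right_dvd q G Y \<Longrightarrow> degree G \<le> degree (gcrd q PI Y)"
    and "m dvd degree (gcrd q PI Y)"
proof -
  note props = K.gcrd_props[OF PI_nonzero]
  show "lead_coeff (gcrd q PI Y) = 1" "right_dvd q (gcrd q PI Y) PI" "right_dvd q (gcrd q PI Y) Y"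
    by (rule props)+
  then show "m dvd degree (gcrd q PI Y)" by (intro dvd_degree_right_divisor)
  assume "right_dvd q G PI" "right_dvd q G Y"
  then have "right_dvd q G (gcrd q PI Y)" by (rule props(4))
  moreover have "gcrd q PI Y \<noteq> 0" using props(1)[of Y] by auto
  ultimately show "degree G \<le> degree (gcrd q PI Y)" by (rule K.right_dvd_degree_le)
qed

lemma m_dvd_N: "m dvd N"
  by (simp add: degree_PI)

lemma nonzero_codeword:
  assumes "y \<in> carrier PR" "y \<noteq> \<zero>\<^bsub>PR\<^esub>"
  obtains Y where "Y \<in> polys_below N" "Y \<noteq> 0" "y = crt Y"
proof -
  obtain Y where "Y \<in> polys_below N" "y = crt Y"
    using assms(1) unfolding carrier_PR(1) by auto
  moreover from this(2) have "Y \<noteq> 0" using assms(2) crt_0 by auto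
  ultimately show ?thesis by (intro that)
qed

text \<open>The gcrd right divides the nonzero lift, whose degree is less than \<open>N\<close>, so
  the weight is positive. It is a multiple of \<open>m\<close> because \<open>N\<close> and the
  degree of the gcrd are.\<close>

lemma wt_ps_props:
  assumes "y \<in> carrier PR" "y \<noteq> \<zero>\<^bsub>PR\<^esub>"
  shows "m dvd wt_ps q Qs y" "0 < wt_ps q Qs y" "wt_ps q Qs y \<le> N"
proof -
  obtain Y where Y: "Y \<in> polys_below N" "Y \<noteq> 0" "y = crt Y"
    using nonzero_codeword[OF assms] .
  have wt: "wt_ps q Qs y = N - degree (gcrd q PI Y)" using Y wt_crt by simp
  have "degree (gcrd q PI Y) \<le> degree Y"
    using K.right_dvd_degree_le[OF gcrd_PI(3) Y(2)] .
  also have "degree Y < N" using Y by (simp add: polys_below_iff)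
  finally show "0 < wt_ps q Qs y" using wt by simp
  show "m dvd wt_ps q Qs y" unfolding wt by (intro dvd_diff_nat m_dvd_N gcrd_PI(5))
  show "wt_ps q Qs y \<le> N" unfolding wt by simp
qed

lemma d_ps_attained:
  assumes "y \<in> D" "y \<noteq> \<zero>\<^bsub>PR\<^esub>"
  obtains z where "z \<in> D" "z \<noteq> \<zero>\<^bsub>PR\<^esub>" "wt_ps q Qs z = d_ps q Qs D"
proof -
  have "\<exists>w. \<exists>y\<in>D. y \<noteq> \<zero>\<^bsub>PR\<^esub> \<and> wt_ps q Qs y = w" using assms by blast
  from LeastI_ex[OF this] have "\<exists>y\<in>D. y \<noteq> \<zero>\<^bsub>PR\<^esub> \<and> wt_ps q Qs y = d_ps q Qs D"
    unfolding d_ps_def .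
  then show ?thesis by (elim bexE conjE) (rule that)
qed

lemma d_ps_le: "y \<in> D \<Longrightarrow> y \<noteq> \<zero>\<^bsub>PR\<^esub> \<Longrightarrow> d_ps q Qs D \<le> wt_ps q Qs y"
  unfolding d_ps_def by (intro Least_le bexI[of _ y] conjI refl)

text \<open>
  If \<open>G\<close> is a right divisor of \<open>\<Pi>\<close> of degree \<open>N - ms\<close>, the left ideal generated by \<open>G\<close> modulo \<open>\<Pi>\<close>
  consists of \<open>q\<^sup>r\<^sup>m\<^sup>s\<close> elements of weight at most \<open>ms\<close>. Hence it meets a code of minimum distance
  greater than \<open>ms\<close> trivially.
\<close>

lemma card_code_bound:
  assumes D: "subgroup D (add_monoid PR)" and s: "s \<le> l * r" and "m * s < d_ps q Qs D"
  shows "card D * q ^ (r * (m * s)) \<le> q ^ (r * (m * (l * r)))"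
proof -
  have D_carr: "D \<subseteq> carrier PR" using subgroup.subset[OF D] by simp
  have D_minus: "x \<ominus>\<^bsub>PR\<^esub> y \<in> D" if "x \<in> D" "y \<in> D" for x y
    using subgroup.m_closed[OF D that(1) subgroup.m_inv_closed[OF D that(2)]]
    by (simp add: a_minus_def a_inv_def)
  obtain G where G: "lead_coeff G = 1" "right_dvd q G PI" "degree G = m * (l * r - s)"
    by (rule ex_monic_right_divisor[of "l * r - s"]) auto
  have G0: "G \<noteq> 0" using G(1) by auto
  have N: "N = m * s + degree G"
    using s by (simp add: degree_PI G(3) mult.assoc flip: distrib_left)
  have below: "skew_mult q B G \<in> polys_below N" if "B \<in> polys_below (m * s)" for B
    using that G0 by (cases "B = 0") (auto simp: polys_below_iff N K.degree_skew)
  have trivial: "B = 0" if B: "B \<in> polys_below (m * s)" and "crt (skew_mult q B G) \<in> D" for B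
  proof (rule ccontr)
    assume "B \<noteq> 0"
    let ?Y = "skew_mult q B G"
    have "right_dvd q G ?Y" unfolding right_dvd_def by blast
    then have deg: "N - degree (gcrd q PI ?Y) \<le> m * s"
      using gcrd_PI(4)[OF G(2), of ?Y] N by simp
    have "crt ?Y \<noteq> \<zero>\<^bsub>PR\<^esub>"
      using \<open>B \<noteq> 0\<close> G0 crt_eq_0_iff[OF below[OF B]] by simp
    then have "d_ps q Qs D \<le> wt_ps q Qs (crt ?Y)"
      using that(2) by (intro d_ps_le)
    also have "\<dots> = N - degree (gcrd q PI ?Y)" by (rule wt_crt[OF below[OF B]])
    also have "\<dots> \<le> m * s" by (rule deg)
    finally show False using assms(3) by simp
  qed
  let ?h = "\<lambda>(x, B). x \<oplus>\<^bsub>PR\<^esub> crt (skew_mult q B G)"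
  \<comment> \<open>Trivial intersection with \<open>D\<close> makes the sum of \<open>D\<close> and
    the multiples of \<open>G\<close> direct, so the orders multiply within the product
    ring.\<close>
  have "inj_on ?h (D \<times> polys_below (m * s))"
  proof (rule inj_onI; clarify)
    fix x B x' B'
    assume x: "x \<in> D" "x' \<in> D" and B: "B \<in> polys_below (m * s)" "B' \<in> polys_below (m * s)"
      and eq: "x \<oplus>\<^bsub>PR\<^esub> crt (skew_mult q B G) = x' \<oplus>\<^bsub>PR\<^esub> crt (skew_mult q B' G)"
    have carr: "x \<in> carrier PR" "x' \<in> carrier PR" using x D_carr by auto
    have "crt (skew_mult q B' G) = crt (skew_mult q (B' - B) G) \<oplus>\<^bsub>PR\<^esub> crt (skew_mult q B G)"
      by (simp add: K.skew_diff_left flip: crt_add)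
    then have "x \<oplus>\<^bsub>PR\<^esub> crt (skew_mult q B G) =
        (x' \<oplus>\<^bsub>PR\<^esub> crt (skew_mult q (B' - B) G)) \<oplus>\<^bsub>PR\<^esub> crt (skew_mult q B G)"
      using eq carr by (simp add: crt.S.a_assoc)
    then have x_eq: "x = x' \<oplus>\<^bsub>PR\<^esub> crt (skew_mult q (B' - B) G)"
      using carr by simp
    then have "x \<ominus>\<^bsub>PR\<^esub> x' = crt (skew_mult q (B' - B) G)"
      using carr by (simp add: a_minus_def crt.S.a_ac crt.S.r_neg1 crt.S.r_neg2)
    then have "crt (skew_mult q (B' - B) G) \<in> D"
      using D_minus[OF x] by simp
    then have "B' - B = 0" using trivial polys_below_diff B by blast
    then show "x = x' \<and> B = B'" using x_eq carr by (simp add: crt_0)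
  qed
  then have "card D * (q ^ r) ^ (m * s) = card (?h ` (D \<times> polys_below (m * s)))"
    by (simp add: card_image card_cartesian_product card_polys_below_a)
  also have "\<dots> \<le> card (carrier PR)"
    using D_carr by (intro card_mono carrier_PR(2)) auto
  also have "\<dots> = (q ^ r) ^ N" by (rule carrier_PR(3))
  finally show ?thesis by (simp add: degree_PI mult_ac flip: power_mult)
qed

text \<open>The distance is a positive multiple of \<open>m\<close>; written as
  \<open>m * Suc s\<close>, it makes \<open>s\<close> the largest value to which
  \<open>card_code_bound\<close> applies.\<close>

lemma card_code_singleton:
  assumes D: "subgroup D (add_monoid PR)" and "D \<noteq> {\<zero>\<^bsub>PR\<^esub>}"
  obtains s where "d_ps q Qs D = m * Suc s" "Suc s \<le> l * r"
    "card D * q ^ (r * (m * s)) \<le> q ^ (r * (m * (l * r)))"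
proof -
  have D_carr: "D \<subseteq> carrier PR" using subgroup.subset[OF D] by simp
  have "\<zero>\<^bsub>PR\<^esub> \<in> D" using subgroup.one_closed[OF D] by simp
  with assms(2) obtain y where "y \<in> D" "y \<noteq> \<zero>\<^bsub>PR\<^esub>" by blast
  then obtain z where z: "z \<in> D" "z \<noteq> \<zero>\<^bsub>PR\<^esub>" "wt_ps q Qs z = d_ps q Qs D"
    by (rule d_ps_attained)
  note props = wt_ps_props[of z, unfolded z(3)]
  have "m dvd d_ps q Qs D" using props(1) z D_carr by blast
  then obtain k where k: "d_ps q Qs D = m * k" by (rule dvdE)
  have "0 < m * k" "m * k \<le> N" using props(2,3) z D_carr k by auto
  then have "0 < k" "k \<le> l * r" using m_pos by (auto simp: degree_PI mult.assoc)
  then obtain s where s: "k = Suc s" using gr0_implies_Suc by blast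
  have "m * s < d_ps q Qs D" using k s m_pos by simp
  then have "card D * q ^ (r * (m * s)) \<le> q ^ (r * (m * (l * r)))"
    using \<open>k \<le> l * r\<close> s by (intro card_code_bound[OF D]) auto
  with that k s \<open>k \<le> l * r\<close> show ?thesis by blast
qed

text \<open>Here \<open>card D\<close> is \<open>q ^ \<kappa>\<close>, so exponents can be compared.
  The real quotient of the distance by \<open>m\<close> is exactly \<open>s + 1\<close>, which
  absorbs the final 1.\<close>

lemma Fq_code_bound:
  assumes "D \<noteq> {\<zero>\<^bsub>PR\<^esub>}" "subalgebra (scalars q Qs (range \<iota>)) D PR"
    "ring.dimension PR \<kappa> (scalars q Qs (range \<iota>)) D"
  shows "real \<kappa> \<le> real m * real r * (real l * real r - real (d_ps q Qs D) / real m + 1)"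
proof -
  obtain s where s: "d_ps q Qs D = m * Suc s" "card D * q ^ (r * (m * s)) \<le> q ^ (r * (m * (l * r)))"
    using card_code_singleton[OF subalgebra.axioms(1)[OF assms(2)] assms(1)] by blast
  have "card D = q ^ \<kappa>"
    using card_of_dimension[OF subfield_Fq assms(3)] by (simp add: card_Fq)
  then have "q ^ (\<kappa> + r * (m * s)) \<le> q ^ (r * (m * (l * r)))"
    using s(2) by (simp add: power_add)
  then have "\<kappa> + r * (m * s) \<le> r * (m * (l * r))"
    using power_le_imp_le_exp[OF K.q_gt_1] by blast
  then have "real (\<kappa> + r * (m * s)) \<le> real (r * (m * (l * r)))"
    using of_nat_le_iff by blast
  then show ?thesis using m_pos by (simp add: s(1) algebra_simps)
qed

text \<open>All exponents carry the factor \<open>r\<close>, which cancels. Since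
  \<open>l * r - s\<close> is an integer, the bound on \<open>k / m\<close> passes to the
  ceiling.\<close>

lemma Fqr_code_bound:
  assumes "D \<noteq> {\<zero>\<^bsub>PR\<^esub>}" "subalgebra (scalars q Qs UNIV) D PR"
    "ring.dimension PR k (scalars q Qs UNIV) D"
  shows "int (d_ps q Qs D) \<le> int m * (int l * int r - \<lceil>real k / real m\<rceil> + 1)"
proof -
  obtain s where s: "d_ps q Qs D = m * Suc s" "card D * q ^ (r * (m * s)) \<le> q ^ (r * (m * (l * r)))"
    using card_code_singleton[OF subalgebra.axioms(1)[OF assms(2)] assms(1)] by blast
  have "card D = q ^ (r * k)"
    using card_of_dimension[OF subfield_Fqr assms(3)] by (simp add: card_Fqr power_mult)
  then have "q ^ (r * k + r * (m * s)) \<le> q ^ (r * (m * (l * r)))"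
    using s(2) by (simp add: power_add)
  then have "r * k + r * (m * s) \<le> r * (m * (l * r))"
    using power_le_imp_le_exp[OF K.q_gt_1] by blast
  then have "k + m * s \<le> m * (l * r)"
    using r_pos by (simp flip: distrib_left)
  then have "real (k + m * s) \<le> real (m * (l * r))"
    using of_nat_le_iff by blast
  then have "real k \<le> (real l * real r - real s) * real m"
    by (simp add: algebra_simps)
  then have "real k / real m \<le> of_int (int l * int r - int s)"
    using m_pos by (simp add: pos_divide_le_eq)
  then have "\<lceil>real k / real m\<rceil> \<le> int l * int r - int s"
    by (simp add: ceiling_le_iff)
  then have "int m * (1 + int s) \<le> int m * (int l * int r - \<lceil>real k / real m\<rceil> + 1)"
    by (intro mult_left_mono) auto
  moreover have "int (d_ps q Qs D) = int m * (1 + int s)"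
    by (simp add: s(1) distrib_left)
  ultimately show ?thesis by (simp only:)
qed

lemma SCRT_code:
  assumes t: "1 \<le> t" "t \<le> l * r"
  shows "subalgebra (scalars q Qs UNIV) (SCRT q Qs (m * t)) PR"
    and "ring.dimension PR (m * t) (scalars q Qs UNIV) (SCRT q Qs (m * t))"
    and "int (d_ps q Qs (SCRT q Qs (m * t))) = int m * (int l * int r - int t + 1)"
proof -
  have N: "N = m * (l * r)" by (simp add: degree_PI)
  have mt: "0 < m * t" "m * t \<le> N" using t m_pos by (auto simp: N)
  \<comment> \<open>The descriptions by degree and by coefficients agree because
    \<open>m * t > 0\<close>, so 0 belongs to both.\<close>
  have SCRT: "SCRT q Qs (m * t) = crt ` polys_below (m * t)"
    using mt by (auto simp: SCRT_def polys_below_iff)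
  show dim: "ring.dimension PR (m * t) (scalars q Qs UNIV) (SCRT q Qs (m * t))"
    unfolding SCRT by (rule dimension_crt_polys_below[OF mt(2)])
  show "subalgebra (scalars q Qs UNIV) (SCRT q Qs (m * t)) PR"
    by (rule crt.S.finite_dimension_imp_subalgebra[OF subfield_Fqr crt.S.finite_dimensionI[OF dim]])
  obtain u where u: "t = Suc u" using t gr0_implies_Suc[of t] by auto
  have sub: "Y \<in> polys_below N" if "Y \<in> polys_below (m * t)" for Y :: "'a poly"
    using that mt(2) by (auto simp: polys_below_def)
  have "d_ps q Qs (SCRT q Qs (m * t)) = N - m * u"
    unfolding d_ps_def
  proof (rule Least_equality)
    obtain G where G: "lead_coeff G = 1" "right_dvd q G PI" "degree G = m * u"
      by (rule ex_monic_right_divisor[of u]) (use t u in auto)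
    have G0: "G \<noteq> 0" using G(1) by auto
    have below: "G \<in> polys_below (m * t)" using G(3) m_pos u by (simp add: polys_below_iff)
    have "right_dvd q G G" unfolding right_dvd_def by (rule exI[of _ 1]) simp
    \<comment> \<open>A right divisor \<open>G\<close> of \<open>PI\<close> of degree
      \<open>m * (t - 1)\<close> has a gcrd with \<open>PI\<close> of its own degree, so its
      codeword attains the claimed distance.\<close>
    then have "degree (gcrd q PI G) = degree G"
      using gcrd_PI(4)[OF G(2)] K.right_dvd_degree_le[OF gcrd_PI(3) G0] by (intro antisym)
    then have "wt_ps q Qs (crt G) = N - m * u"
      using wt_crt[OF sub[OF below]] G(3) by simp
    moreover have "crt G \<noteq> \<zero>\<^bsub>PR\<^esub>" using crt_eq_0_iff[OF sub[OF below]] G0 by simp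
    ultimately show "\<exists>y\<in>SCRT q Qs (m * t). y \<noteq> \<zero>\<^bsub>PR\<^esub> \<and> wt_ps q Qs y = N - m * u"
      unfolding SCRT using below by blast
  next
    fix w assume "\<exists>y\<in>SCRT q Qs (m * t). y \<noteq> \<zero>\<^bsub>PR\<^esub> \<and> wt_ps q Qs y = w"
    then obtain Y where Y: "Y \<in> polys_below (m * t)" "crt Y \<noteq> \<zero>\<^bsub>PR\<^esub>" "w = wt_ps q Qs (crt Y)"
      unfolding SCRT by blast
    have Y0: "Y \<noteq> 0" using Y(2) crt_0 by auto
    obtain j where j: "degree (gcrd q PI Y) = m * j" using gcrd_PI(5) by (rule dvdE)
    have "m * j \<le> degree Y" using K.right_dvd_degree_le[OF gcrd_PI(3) Y0] j by simp
    also have "degree Y < m * Suc u" using Y(1) Y0 u by (simp add: polys_below_iff)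
    \<comment> \<open>Divisibility by \<open>m\<close> sharpens degree less than
      \<open>m * t\<close> to degree at most \<open>m * (t - 1)\<close>; this gap is the summand
      \<open>m\<close> in the distance.\<close>
    finally have "j < Suc u" by (simp only: mult_less_cancel1)
    then have "N - m * u \<le> N - m * j"
      by (intro diff_le_mono2 mult_le_mono2) simp
    then show "N - m * u \<le> w"
      using Y(3) wt_crt[OF sub[OF Y(1)]] j by simp
  qed
  moreover have "m * u \<le> N" using mt u by simp
  ultimately show "int (d_ps q Qs (SCRT q Qs (m * t))) = int m * (int l * int r - int t + 1)"
    by (simp add: N u of_nat_diff algebra_simps)
qed

end

theorem corollary4p7:
  fixes q r m l N :: nat
    and \<iota> :: "'f::{field,finite} \<Rightarrow> 'a::{field,finite}"
    and qs :: "'f poly list"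
    and Qs :: "'a poly list"
    and Fq Fqr :: "'a poly set list set"
  assumes "card (UNIV :: 'f set) = q" and "card (UNIV :: 'a set) = q ^ r"
    and "\<And>x y. \<iota> (x + y) = \<iota> x + \<iota> y" and "\<And>x y. \<iota> (x * y) = \<iota> x * \<iota> y" and "\<iota> 1 = 1"
    and "1 \<le> r" and "1 \<le> m" and "1 \<le> l"
    and "length qs = l" and "distinct qs"
    and "\<And>f. f \<in> set qs \<Longrightarrow> lead_coeff f = 1 \<and> Factorial_Ring.irreducible f \<and> degree f = m \<and> f \<noteq> [:0, 1:]"
    and "Qs = map (eval_tau_pow q r \<iota>) qs"
    and "N = degree (Pi_poly q Qs)"
    and "Fq = scalars q Qs (range \<iota>)" and "Fqr = scalars q Qs UNIV"
  shows
    "(\<forall>D \<kappa>. D \<noteq> {\<zero>\<^bsub>prod_ring q Qs\<^esub>} \<and> subalgebra Fq D (prod_ring q Qs) \<and>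
        ring.dimension (prod_ring q Qs) \<kappa> Fq D \<longrightarrow>
        real \<kappa> \<le> real m * real r * (real l * real r - real (d_ps q Qs D) / real m + 1)) \<and>
     (\<forall>D K. D \<noteq> {\<zero>\<^bsub>prod_ring q Qs\<^esub>} \<and> subalgebra Fqr D (prod_ring q Qs) \<and>
        ring.dimension (prod_ring q Qs) K Fqr D \<longrightarrow>
        int (d_ps q Qs D) \<le> int m * (int l * int r - \<lceil>real K / real m\<rceil> + 1)) \<and>
     (\<forall>t. 1 \<le> t \<and> t \<le> l * r \<longrightarrow>
        (\<exists>K. subalgebra Fqr (SCRT q Qs (m * t)) (prod_ring q Qs) \<and>
           ring.dimension (prod_ring q Qs) K Fqr (SCRT q Qs (m * t)) \<and> K = m * t \<and>
           int (d_ps q Qs (SCRT q Qs (m * t))) = int m * (int l * int r - int t + 1) \<and>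
           int m * (int l * int r - int t + 1) = int N - int K + int m))"
proof -
  interpret skew_crt q r m l \<iota> qs
    by unfold_locales (fact assms)+
  have N: "int N = int m * (int l * int r)"
    unfolding assms(13,12) degree_PI by simp
  show ?thesis
    unfolding assms(14,15,12)
  proof (intro conjI allI impI; (elim conjE)?)
    fix t assume t: "1 \<le> t" "t \<le> l * r"
    have "int m * (int l * int r - int t + 1) = int N - int (m * t) + int m"
      by (simp add: N algebra_simps)
    with SCRT_code[OF t] show "\<exists>K. subalgebra (scalars q (map (eval_tau_pow q r \<iota>) qs) UNIV)
          (SCRT q (map (eval_tau_pow q r \<iota>) qs) (m * t)) (prod_ring q (map (eval_tau_pow q r \<iota>) qs)) \<and>
        ring.dimension (prod_ring q (map (eval_tau_pow q r \<iota>) qs)) K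
          (scalars q (map (eval_tau_pow q r \<iota>) qs) UNIV) (SCRT q (map (eval_tau_pow q r \<iota>) qs) (m * t)) \<and>
        K = m * t \<and>
        int (d_ps q (map (eval_tau_pow q r \<iota>) qs) (SCRT q (map (eval_tau_pow q r \<iota>) qs) (m * t))) =
          int m * (int l * int r - int t + 1) \<and>
        int m * (int l * int r - int t + 1) = int N - int K + int m"
      by blast
  qed (rule Fq_code_bound Fqr_code_bound; assumption)+
qed

end
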